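(* Let $F$ and $G$ be experiments on the state space $\Theta=\{\theta_0,\ldots,\theta_n\}$. The following are equivalent: (i) $F\succeq_{\textup{LB}}G$; (ii) $\overline{V}_F(\boldsymbol{q})\ge\overline{V}_G(\boldsymbol{q})$ for every QCC decision problem and every $\boldsymbol{q}\in\widehat{\Delta}_n$; (iii) for every QCC decision problem $\{\mathcal{A},u\}$ and every strategy $\sigma_G$ under $G$, there exists a strategy $\sigma_F$ under $F$ with $u(\sigma_F,\theta)\ge u(\sigma_G,\theta)$ for each $\theta\in\Theta$.
   Context: States: $\Theta=\{\theta_0,\ldots,\theta_n\}\subset\mathbb{R}$. An experiment $F$ specifies, for each $\theta$, an absolutely continuous distribution $F(\cdot\mid\theta)$ with density $f(\cdot\mid\theta)$ of a signal in a compact interval $\mathcal{X}$; likewise $G$ with densities $g(\cdot\mid\theta)$ on a compact interval $\mathcal{Y}$. $\widehat{\Delta}_n=\{\boldsymbol{q}\in[0,1]^n:\sum_iq_i\le1\}$; a belief $\boldsymbol{p}\in\widehat{\Delta}_n$ puts mass $p_i$ on $\theta_i$ ($i\ge1$) and $p_0=1-\sum_ip_i$ on $\theta_0$. Posterior $p_{F,i}(x;\boldsymbol{q})=q_if(x\mid\theta_i)/\sum_jq_jf(x\mid\theta_j)$; $\boldsymbol{p}_F(\boldsymbol{q})=(p_{F,1},\ldots,p_{F,n})(X;\boldsymbol{q})$ with $X\sim\sum_jq_jF(\cdot\mid\theta_j)$ (analogously for $G$). $F\succeq_{\textup{LB}}G$ means: for every $\boldsymbol{q}\in\widehat{\Delta}_n$,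 $\boldsymbol{b}\in\mathbb{R}^n$ and convex $C:\mathbb{R}\to\mathbb{R}$, $\mathbb{E}[C(\boldsymbol{b}\cdot\boldsymbol{p}_F(\boldsymbol{q}))]\ge\mathbb{E}[C(\boldsymbol{b}\cdot\boldsymbol{p}_G(\boldsymbol{q}))]$. A decision problem $\{\mathcal{A},u\}$ here has $\mathcal{A}\subset\mathbb{R}$ and $u:\mathcal{A}\times\Theta\to\mathbb{R}$, where either $\mathcal{A}$ is finite, or $\mathcal{A}$ is a compact interval and $u(a,\theta)$ is differentiable in $a$ for every $\theta$. Let $u(a,\boldsymbol{p})=\sum_{i=0}^np_iu(a,\theta_i)$; the problem is quasi-concave (QCC) if $a\mapsto u(a,\boldsymbol{p})$ is quasi-concave on $\mathcal{A}$ for every $\boldsymbol{p}\in\widehat{\Delta}_n$. $V(\boldsymbol{p})=\max_{a\in\mathcal{A}}u(a,\boldsymbol{p})$, $\overline{V}_F(\boldsymbol{q})=\mathbb{E}[V(\boldsymbol{p}_F(\boldsymbol{q}))]$. A strategy under $F$ is a measurable $\sigma_F:\mathcal{X}\to\Delta(\mathcal{A})$ with $u(\sigma_F,\theta)=\int_{\mathcal{X}}\int_{\mathcal{A}}u(a,\theta)\,\sigma_F(x)(da)\,dF(x\mid\theta)$; analogously for $G$. *)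

theory Defs
  imports "HOL-Probability.Probability"
begin

(* States theta_0,...,theta_n are represented by their indices 0..n.
   A belief q in \<Delta>-hat_n is a function nat => real of which only q 1,...,q n matter;
   the mass on theta_0 is 1 - sum of the others. *)

definition belief_simplex :: "nat \<Rightarrow> (nat \<Rightarrow> real) set" where
  "belief_simplex n = {q. (\<forall>i\<in>{1..n}. 0 \<le> q i \<and> q i \<le> 1) \<and> (\<Sum>i=1..n. q i) \<le> 1}"

definition full_belief :: "nat \<Rightarrow> (nat \<Rightarrow> real) \<Rightarrow> nat \<Rightarrow> real" where
  "full_belief n q i = (if i = 0 then 1 - (\<Sum>j=1..n. q j) else q i)"

definition is_experiment :: "nat \<Rightarrow> real \<Rightarrow> real \<Rightarrow> (nat \<Rightarrow> real \<Rightarrow> real) \<Rightarrow> bool" where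
  "is_experiment n a b f \<longleftrightarrow> a \<le> b \<and>
     (\<forall>i\<le>n. (\<forall>x\<in>{a..b}. 0 \<le> f i x) \<and> set_integrable lborel {a..b} (f i) \<and>
             (LINT x:{a..b}|lborel. f i x) = 1)"

definition mix_density :: "nat \<Rightarrow> (nat \<Rightarrow> real \<Rightarrow> real) \<Rightarrow> (nat \<Rightarrow> real) \<Rightarrow> real \<Rightarrow> real" where
  "mix_density n f q x = (\<Sum>j=0..n. full_belief n q j * f j x)"

definition posterior :: "nat \<Rightarrow> (nat \<Rightarrow> real \<Rightarrow> real) \<Rightarrow> (nat \<Rightarrow> real) \<Rightarrow> real \<Rightarrow> nat \<Rightarrow> real" where
  "posterior n f q x i = full_belief n q i * f i x / mix_density n f q x"

definition post_expect :: "nat \<Rightarrow> real \<Rightarrow> real \<Rightarrow> (nat \<Rightarrow> real \<Rightarrow> real) \<Rightarrow> (nat \<Rightarrow> real)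
     \<Rightarrow> ((nat \<Rightarrow> real) \<Rightarrow> real) \<Rightarrow> real" where
  "post_expect n a b f q h = (LINT x:{a..b}|lborel. h (posterior n f q x) * mix_density n f q x)"

definition lb_dominates :: "nat \<Rightarrow> real \<Rightarrow> real \<Rightarrow> (nat \<Rightarrow> real \<Rightarrow> real)
     \<Rightarrow> real \<Rightarrow> real \<Rightarrow> (nat \<Rightarrow> real \<Rightarrow> real) \<Rightarrow> bool" where
  "lb_dominates n a b f c d g \<longleftrightarrow>
     (\<forall>q\<in>belief_simplex n. \<forall>bv :: nat \<Rightarrow> real. \<forall>C :: real \<Rightarrow> real. convex_on UNIV C \<longrightarrow>
        post_expect n c d g q (\<lambda>p. C (\<Sum>i=1..n. bv i * p i))
          \<le> post_expect n a b f q (\<lambda>p. C (\<Sum>i=1..n. bv i * p i)))"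

definition decision_problem :: "nat \<Rightarrow> real set \<Rightarrow> (real \<Rightarrow> nat \<Rightarrow> real) \<Rightarrow> bool" where
  "decision_problem n A u \<longleftrightarrow> A \<noteq> {} \<and>
     (finite A \<or> (\<exists>c d. c \<le> d \<and> A = {c..d} \<and> (\<forall>i\<le>n. (\<lambda>a. u a i) differentiable_on A)))"

definition exp_util :: "nat \<Rightarrow> (real \<Rightarrow> nat \<Rightarrow> real) \<Rightarrow> real \<Rightarrow> (nat \<Rightarrow> real) \<Rightarrow> real" where
  "exp_util n u a p = (\<Sum>i=0..n. full_belief n p i * u a i)"

definition quasiconcave_on :: "real set \<Rightarrow> (real \<Rightarrow> real) \<Rightarrow> bool" where
  "quasiconcave_on A h \<longleftrightarrow>
     (\<forall>x\<in>A. \<forall>y\<in>A. \<forall>t\<in>{0..1}. (1 - t) * x + t * y \<in> A \<longrightarrow> min (h x) (h y) \<le> h ((1 - t) * x + t * y))"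

definition QCC :: "nat \<Rightarrow> real set \<Rightarrow> (real \<Rightarrow> nat \<Rightarrow> real) \<Rightarrow> bool" where
  "QCC n A u \<longleftrightarrow> (\<forall>p\<in>belief_simplex n. quasiconcave_on A (\<lambda>a. exp_util n u a p))"

definition value_fn :: "nat \<Rightarrow> real set \<Rightarrow> (real \<Rightarrow> nat \<Rightarrow> real) \<Rightarrow> (nat \<Rightarrow> real) \<Rightarrow> real" where
  "value_fn n A u p = (SUP a\<in>A. exp_util n u a p)"

definition Vbar :: "nat \<Rightarrow> real \<Rightarrow> real \<Rightarrow> (nat \<Rightarrow> real \<Rightarrow> real) \<Rightarrow> real set
     \<Rightarrow> (real \<Rightarrow> nat \<Rightarrow> real) \<Rightarrow> (nat \<Rightarrow> real) \<Rightarrow> real" where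
  "Vbar n a b f A u q = post_expect n a b f q (value_fn n A u)"

definition is_strategy :: "real \<Rightarrow> real \<Rightarrow> real set \<Rightarrow> (real \<Rightarrow> real measure) \<Rightarrow> bool" where
  "is_strategy a b A \<sigma> \<longleftrightarrow>
     \<sigma> \<in> measurable (restrict_space borel {a..b}) (prob_algebra (restrict_space borel A))"

definition strat_util :: "real \<Rightarrow> real \<Rightarrow> (nat \<Rightarrow> real \<Rightarrow> real) \<Rightarrow> (real \<Rightarrow> nat \<Rightarrow> real)
     \<Rightarrow> (real \<Rightarrow> real measure) \<Rightarrow> nat \<Rightarrow> real" where
  "strat_util a b f u \<sigma> i = (LINT x:{a..b}|lborel. (\<integral>t. u t i \<partial>(\<sigma> x)) * f i x)"

end

theory Submission
  imports Defs
begin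

text \<open>
  For a finite quasi-concave problem with actions \<open>a\<^sub>1 < \<dots> < a\<^sub>m\<close>, expected utility first rises and
  then falls along the actions, so the value is \<open>u(a\<^sub>1,p)\<close> plus the positive parts of the increments
  \<open>u(a\<^sub>k\<^sub>+\<^sub>1,p) - u(a\<^sub>k,p)\<close>; each summand is a convex function of a linear form in \<open>p\<close>, whence
  (i) implies (ii), and interval problems are uniform limits of their finite subproblems. Conversely a
  convex function is, up to \<open>\<epsilon>\<close>, a maximum of tangents, and choosing the tangent point is a
  quasi-concave problem.

  A near-optimal strategy under \<open>G\<close> that is matched under \<open>F\<close> state by state yields (ii) from (iii). For
  the converse, every weighting of the states admits a strategy under \<open>F\<close> with at least the weighted
  payoff of the given strategy under \<open>G\<close>. A projection argument then dominates that payoff vector up to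
  \<open>\<epsilon>\<close>, and the \<open>\<epsilon>\<close> is removed by taking elements of nearly minimal \<open>L\<^sup>2\<close> norm in the decreasing
  convex sets of \<open>1/k\<close>-dominating strategies, which converge almost everywhere along a subsequence.
  In the finite case these sets consist of mixed strategies; on an interval they consist of profiles
  dominated by a pure action, which form a convex set thanks to quasi-concavity.
\<close>

subsection \<open>Almost everywhere limits in decreasing convex sets\<close>

text \<open>By monotone convergence the integral of the sum is the sum of the integrals; this is
  finite, so the sum itself is finite almost everywhere.\<close>

lemma AE_summable_of_summable_integrals:
  fixes h :: "nat \<Rightarrow> 'a \<Rightarrow> real"
  assumes int: "\<And>k. integrable M (h k)"
    and nonneg: "\<And>k x. x \<in> space M \<Longrightarrow> 0 \<le> h k x"
    and sum: "summable (\<lambda>k. \<integral>x. h k x \<partial>M)"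
  shows "AE x in M. summable (\<lambda>k. h k x)"
proof -
  have meas: "(\<lambda>x. ennreal (h k x)) \<in> borel_measurable M" for k
    using int[of k] by measurable
  have int_eq: "(\<integral>\<^sup>+x. ennreal (h k x) \<partial>M) = ennreal (\<integral>x. h k x \<partial>M)" for k
    by (rule nn_integral_eq_integral[OF int]) (use nonneg in auto)
  have int_nonneg: "0 \<le> (\<integral>x. h k x \<partial>M)" for k
    by (rule Bochner_Integration.integral_nonneg) (use nonneg in auto)
  have "(\<integral>\<^sup>+x. (\<Sum>k. ennreal (h k x)) \<partial>M) = (\<Sum>k. \<integral>\<^sup>+x. ennreal (h k x) \<partial>M)"
    by (rule nn_integral_suminf) (use meas in auto)
  also have "\<dots> = ennreal (\<Sum>k. \<integral>x. h k x \<partial>M)"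
    unfolding int_eq by (rule suminf_ennreal2[OF int_nonneg sum])
  finally have "(\<integral>\<^sup>+x. (\<Sum>k. ennreal (h k x)) \<partial>M) \<noteq> \<infinity>"
    by simp
  then have "AE x in M. (\<Sum>k. ennreal (h k x)) \<noteq> \<infinity>"
    by (intro nn_integral_PInf_AE) (use meas in auto)
  then show ?thesis
  proof (rule AE_mp, intro AE_I2 impI)
    fix x assume x: "x \<in> space M" and fin: "(\<Sum>k. ennreal (h k x)) \<noteq> \<infinity>"
    show "summable (\<lambda>k. h k x)"
      by (rule summable_suminf_not_top) (use nonneg[OF x] fin in auto)
  qed
qed

text \<open>As the sets shrink, the infimum of the squared norm over them increases and stays
  bounded. By the parallelogram law near-minimisers form a Cauchy sequence, and a subsequence with
  geometrically small gaps converges almost everywhere. Whether the limit belongs to the sets is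
  left to the caller.\<close>

lemma decreasing_convex_AE_limit:
  fixes W :: "nat \<Rightarrow> ('j \<Rightarrow> 'a \<Rightarrow> real) set"
  assumes M: "finite_measure M" and J: "finite J"
    and ne: "\<And>k. W k \<noteq> {}"
    and dec: "\<And>k. W (Suc k) \<subseteq> W k"
    and mid: "\<And>k w w'. w \<in> W k \<Longrightarrow> w' \<in> W k \<Longrightarrow> (\<lambda>j x. (w j x + w' j x) / 2) \<in> W k"
    and meas: "\<And>k w j. w \<in> W k \<Longrightarrow> j \<in> J \<Longrightarrow> w j \<in> borel_measurable M"
    and bound: "\<And>k w j x. w \<in> W k \<Longrightarrow> j \<in> J \<Longrightarrow> x \<in> space M \<Longrightarrow> \<bar>w j x\<bar> \<le> B"
  obtains v where "\<And>k. v k \<in> W k" "\<And>j. j \<in> J \<Longrightarrow> AE x in M. convergent (\<lambda>k. v k j x)"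
proof -
  interpret finite_measure M by (rule M)
  define N where "N w = (\<Sum>j\<in>J. \<integral>x. (w j x)\<^sup>2 \<partial>M)" for w :: "'j \<Rightarrow> 'a \<Rightarrow> real"
  have mono: "W k \<subseteq> W i" if "i \<le> k" for i k
    using lift_Suc_antimono_le[of W, OF dec that] .
  have intb: "integrable M (\<lambda>x. w j x * w' j x)" if "w \<in> W k" "w' \<in> W i" "j \<in> J" for w w' j k i
  proof (rule integrable_const_bound[of _ "B * B"])
    show "AE x in M. norm (w j x * w' j x) \<le> B * B"
      using bound[OF that(1,3)] bound[OF that(2,3)] 
      by (intro AE_I2) (auto simp: abs_mult intro!: mult_mono order_trans[OF abs_ge_zero])
  qed (use meas[OF that(1,3)] meas[OF that(2,3)] in measurable)
  have int2: "integrable M (\<lambda>x. (w j x)\<^sup>2)" if "w \<in> W k" "j \<in> J" for w j k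
    using intb[OF that(1,1,2)] by (simp add: power2_eq_square)
  have N_nonneg: "0 \<le> N w" for w
    unfolding N_def by (intro sum_nonneg) auto
  have N_bound: "N w \<le> (\<Sum>j\<in>J. B\<^sup>2 * measure M (space M))" if "w \<in> W k" for w k
    unfolding N_def
  proof (rule sum_mono)
    fix j assume j: "j \<in> J"
    have "(\<integral>x. (w j x)\<^sup>2 \<partial>M) \<le> (\<integral>x. B\<^sup>2 \<partial>M)"
      by (rule integral_mono[OF int2[OF that j]]) (use bound[OF that j] in \<open>auto intro: order_trans[OF _ abs_ge_self] simp: abs_le_square_iff[symmetric]\<close>)
    then show "(\<integral>x. (w j x)\<^sup>2 \<partial>M) \<le> B\<^sup>2 * measure M (space M)"
      by (simp add: mult.commute)
  qed
  define m where "m k = Inf (N ` W k)" for k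
  have bdd: "bdd_below (N ` W k)" for k
    by (rule bdd_belowI2[of _ 0]) (rule N_nonneg)
  have m_le: "m k \<le> N w" if "w \<in> W k" for w k
    unfolding m_def by (rule cInf_lower[OF imageI[OF that] bdd])
  have "incseq m"
    unfolding m_def by (intro incseq_SucI cInf_superset_mono bdd image_mono dec) (use ne in auto)
  moreover have "m k \<le> (\<Sum>j\<in>J. B\<^sup>2 * measure M (space M))" for k
    using ne[of k] m_le N_bound by (meson ex_in_conv order_trans)
  ultimately obtain L where L: "m \<longlonglongrightarrow> L" and mL: "\<And>k. m k \<le> L"
    using incseq_convergent[of m] by metis
  define e where "e k = 1 / real (Suc k)" for k
  have e: "0 < e k" for k by (simp add: e_def)
  have "\<exists>w\<in>W k. N w < m k + e k" for k
  proof -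
    have "Inf (N ` W k) < m k + e k" unfolding m_def using e[of k] by simp
    then show ?thesis by (subst (asm) cInf_less_iff) (use ne bdd in auto)
  qed
  then obtain v where vW: "\<And>k. v k \<in> W k" and vN: "\<And>k. N (v k) < m k + e k"
    by metis
  have e_mono: "e i \<le> e k" if "k \<le> i" for i k
    using that by (simp add: e_def frac_le)
  \<comment> \<open>Parallelogram law: the midpoint lies in \<open>W k\<close>, so its squared norm
    is at least \<open>m k\<close>, while \<open>N (v i)\<close> and \<open>N (v k)\<close> are
    below \<open>L + e k\<close> and \<open>m k + e k\<close>.\<close>
  have D: "N (\<lambda>j x. v i j x - v k j x) \<le> 2 * (L - m k) + 4 * e k" if "k \<le> i" for i k
  proof -
    let ?d = "\<lambda>j x. v i j x - v k j x" and ?a = "\<lambda>j x. (v i j x + v k j x) / 2"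
    have viW: "v i \<in> W k" using vW mono[OF that] by blast
    have aW: "?a \<in> W k" by (rule mid[OF viW vW])
    have "N ?d = (\<Sum>j\<in>J. 2 * (\<integral>x. (v i j x)\<^sup>2 \<partial>M) + 2 * (\<integral>x. (v k j x)\<^sup>2 \<partial>M) - 4 * (\<integral>x. (?a j x)\<^sup>2 \<partial>M))"
      unfolding N_def
    proof (rule sum.cong[OF refl])
      fix j assume j: "j \<in> J"
      have "(\<integral>x. (?d j x)\<^sup>2 \<partial>M) = (\<integral>x. 2 * (v i j x)\<^sup>2 + 2 * (v k j x)\<^sup>2 - 4 * (?a j x)\<^sup>2 \<partial>M)"
        by (rule Bochner_Integration.integral_cong) (auto simp: power2_eq_square field_simps)
      also have "\<dots> = 2 * (\<integral>x. (v i j x)\<^sup>2 \<partial>M) + 2 * (\<integral>x. (v k j x)\<^sup>2 \<partial>M) - 4 * (\<integral>x. (?a j x)\<^sup>2 \<partial>M)"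
        using int2[OF vW j, of i] int2[OF vW j, of k] int2[OF aW j] by simp
      finally show "(\<integral>x. (?d j x)\<^sup>2 \<partial>M) = 2 * (\<integral>x. (v i j x)\<^sup>2 \<partial>M) + 2 * (\<integral>x. (v k j x)\<^sup>2 \<partial>M) - 4 * (\<integral>x. (?a j x)\<^sup>2 \<partial>M)" .
    qed
    also have "\<dots> = 2 * N (v i) + 2 * N (v k) - 4 * N ?a"
      unfolding N_def by (simp add: sum.distrib sum_subtractf sum_distrib_left)
    finally show ?thesis
      using m_le[OF aW] vN[of i] vN[of k] e_mono[OF that] mL[of i] by argo
  qed
  have "(\<lambda>k. 2 * (L - m k) + 4 * e k) \<longlonglongrightarrow> 2 * (L - L) + 4 * 0"
    unfolding e_def using LIMSEQ_inverse_real_of_nat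
    by (intro tendsto_intros L) (simp add: inverse_eq_divide)
  then have "\<exists>n0. \<forall>k\<ge>n0. 2 * (L - m k) + 4 * e k < (1/4)^i" for i :: nat
    using order_tendstoD(2)[of "\<lambda>k. 2 * (L - m k) + 4 * e k" 0 sequentially "(1/4)^i"]
    by (simp add: eventually_sequentially)
  then obtain n0 where n0: "\<And>i k. n0 i \<le> k \<Longrightarrow> 2 * (L - m k) + 4 * e k < (1/4)^i"
    by metis
  \<comment> \<open>Summing the thresholds makes \<open>r\<close> monotone and keeps it above both
    \<open>k\<close> and \<open>n0 k\<close>.\<close>
  define r where "r k = k + (\<Sum>i\<le>k. n0 i)" for k
  have r_ge: "k \<le> r k" "n0 k \<le> r k" "r k \<le> r (Suc k)" for k
    unfolding r_def by (auto intro: trans_le_add2 member_le_sum)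
  define v' where "v' k = v (r k)" for k
  have v'W: "v' k \<in> W k" for k
    unfolding v'_def using vW mono[OF r_ge(1)] by blast
  have N': "N (\<lambda>j x. v' (Suc k) j x - v' k j x) \<le> (1/4)^k" for k
    unfolding v'_def using D[OF r_ge(3), of k] n0[OF r_ge(2), of k] by linarith
  have "AE x in M. convergent (\<lambda>k. v' k j x)" if j: "j \<in> J" for j
  proof -
    define d where "d k x = v' (Suc k) j x - v' k j x" for k x
    have int_d: "integrable M (\<lambda>x. (d k x)\<^sup>2)" for k
    proof -
      have "integrable M (\<lambda>x. (v' (Suc k) j x)\<^sup>2 + (v' k j x)\<^sup>2 - 2 * (v' (Suc k) j x * v' k j x))"
        using int2[OF v'W j] intb[OF v'W v'W j] by simp
      then show ?thesis unfolding d_def by (simp add: power2_diff mult.assoc)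
    qed
    have d_le: "(\<integral>x. (d k x)\<^sup>2 \<partial>M) \<le> (1/4)^k" for k
    proof -
      have "(\<integral>x. (d k x)\<^sup>2 \<partial>M) \<le> N (\<lambda>j x. v' (Suc k) j x - v' k j x)"
        unfolding N_def d_def
        by (rule member_le_sum[OF j _ J, of "\<lambda>j. \<integral>x. (v' (Suc k) j x - v' k j x)\<^sup>2 \<partial>M"]) auto
      with N' show ?thesis by (rule order_trans[rotated])
    qed
    \<comment> \<open>The squared gaps integrate to at most \<open>(1/4)^k\<close>, which leaves
      room for the weight \<open>2^k\<close>. The weight is what later turns square summability into
      absolute summability.\<close>
    have "AE x in M. summable (\<lambda>k. 2^k * (d k x)\<^sup>2)"
    proof (rule AE_summable_of_summable_integrals)
      show "summable (\<lambda>k. \<integral>x. 2^k * (d k x)\<^sup>2 \<partial>M)"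
      proof (rule summable_comparison_test'[of "\<lambda>k. (1/2)^k" 0])
        fix k :: nat
        have "2^k * (\<integral>x. (d k x)\<^sup>2 \<partial>M) \<le> 2^k * (1/4)^k"
          by (rule mult_left_mono[OF d_le]) simp
        also have "\<dots> = (1/2)^k" by (simp flip: power_mult_distrib)
        finally show "norm (\<integral>x. 2^k * (d k x)\<^sup>2 \<partial>M) \<le> (1/2)^k" by simp
      qed (simp add: summable_geometric)
    qed (use int_d in auto)
    then show ?thesis
    proof (rule AE_mp, intro AE_I2 impI)
      fix x assume s: "summable (\<lambda>k. 2^k * (d k x)\<^sup>2)"
      have "summable (\<lambda>k. d k x)"
      proof (rule summable_comparison_test'[of "\<lambda>k. (1/2)^k + 2^k * (d k x)\<^sup>2" 0])
        fix k :: nat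
        have p: "(2::real)^k > 0" by simp
        \<comment> \<open>Inequality of arithmetic and geometric means for \<open>(1/2)^k\<close>
          and \<open>2^k * (d k x)\<^sup>2\<close>, whose product is
          \<open>(d k x)\<^sup>2\<close>.\<close>
        have "0 \<le> (1 - 2^k * \<bar>d k x\<bar>)\<^sup>2" by simp
        then have "2 * (2^k * \<bar>d k x\<bar>) \<le> 1 + 2^k * (2^k * (d k x)\<^sup>2)"
          by (simp add: power2_diff power_mult_distrib power2_eq_square algebra_simps)
        then have "2 * (2^k * \<bar>d k x\<bar>) \<le> 2^k * ((1/2)^k + 2^k * (d k x)\<^sup>2)"
          by (simp add: distrib_left flip: power_mult_distrib)
        then have "2^k * (2 * \<bar>d k x\<bar>) \<le> 2^k * ((1/2)^k + 2^k * (d k x)\<^sup>2)"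
          by simp
        then have "2 * \<bar>d k x\<bar> \<le> (1/2)^k + 2^k * (d k x)\<^sup>2"
          using p by (simp only: mult_le_cancel_left_pos)
        then show "norm (d k x) \<le> (1/2)^k + 2^k * (d k x)\<^sup>2" by simp
      qed (intro summable_add s, simp add: summable_geometric)
      then have "convergent (\<lambda>k. \<Sum>i<k. d i x)"
        by (simp add: summable_iff_convergent)
      then have "convergent (\<lambda>k. v' 0 j x + (\<Sum>i<k. d i x))"
        by (intro convergent_add convergent_const)
      moreover have "v' 0 j x + (\<Sum>i<k. d i x) = v' k j x" for k
        unfolding d_def by (subst sum_lessThan_telescope[of "\<lambda>k. v' k j x" k]) simp
      ultimately show "convergent (\<lambda>k. v' k j x)" by simp
    qed
  qed
  with v'W show ?thesis by (rule that)
qed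

subsection \<open>Attaining a payoff vector\<close>

text \<open>A quantitative form of finite-dimensional separation, phrased with infima instead of
  attained minima. The sum of squared shortfalls \<open>J\<close> is driven to zero: if
  \<open>k\<close> falls short of \<open>r\<close>, the normalised shortfalls serve as weights, and
  \<open>opt\<close> supplies a vector towards which \<open>J\<close> decreases to first
  order.\<close>

lemma approx_dominating_vector:
  fixes K :: "(nat \<Rightarrow> real) set" and r :: "nat \<Rightarrow> real"
  assumes bound: "\<And>k i. k \<in> K \<Longrightarrow> i \<le> n \<Longrightarrow> \<bar>k i\<bar> \<le> D"
    and conv: "\<And>k k' s. k \<in> K \<Longrightarrow> k' \<in> K \<Longrightarrow> 0 \<le> s \<Longrightarrow> s \<le> 1 \<Longrightarrow>
      \<exists>k''\<in>K. \<forall>i\<le>n. k'' i = (1 - s) * k i + s * k' i"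
    and opt: "\<And>l e. (\<And>i. i \<le> n \<Longrightarrow> 0 \<le> l i) \<Longrightarrow> (\<Sum>i\<le>n. l i) = 1 \<Longrightarrow> 0 < e \<Longrightarrow>
      \<exists>k\<in>K. (\<Sum>i\<le>n. l i * r i) - e \<le> (\<Sum>i\<le>n. l i * k i)"
    and e: "0 < e"
  shows "\<exists>k\<in>K. \<forall>i\<le>n. r i - e \<le> k i"
proof -
  define J where "J k = (\<Sum>i\<le>n. (max 0 (r i - k i))\<^sup>2)" for k :: "nat \<Rightarrow> real"
  define Q where "Q = (\<Sum>i\<le>n. (\<bar>r i\<bar> + D)\<^sup>2)"
  have J_nonneg: "0 \<le> J k" for k unfolding J_def by (intro sum_nonneg) auto
  have Q_nonneg: "0 \<le> Q" unfolding Q_def by (intro sum_nonneg) auto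
  have ne: "K \<noteq> {}"
  proof -
    have "0 \<le> (if i = 0 then 1 else 0 :: real)" for i :: nat by simp
    from opt[of "\<lambda>i. if i = 0 then 1 else 0" 1, OF this] show ?thesis by auto
  qed
  define m where "m = Inf (J ` K)"
  have bdd: "bdd_below (J ` K)" by (rule bdd_belowI2[of _ 0]) (rule J_nonneg)
  have m_le: "m \<le> J k" if "k \<in> K" for k
    unfolding m_def by (rule cInf_lower[OF imageI[OF that] bdd])
  have m_nonneg: "0 \<le> m" unfolding m_def by (rule cInf_greatest) (use ne J_nonneg in auto)
  \<comment> \<open>Moving a fraction \<open>s\<close> from \<open>k\<close> towards a
    \<open>k'\<close> that is optimal up to \<open>s / Z\<close> for the weights
    \<open>z i / Z\<close> leaves a cross term of order at most \<open>s\<^sup>2\<close>, so to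
    first order only the factor \<open>(1 - s)\<^sup>2\<close> acts on \<open>J k\<close>.\<close>
  have step: "m \<le> (1 - s)\<^sup>2 * J k + s\<^sup>2 * (Q + 2)" if k: "k \<in> K" and s: "0 < s" "s < 1" for k s
  proof -
    define z where "z i = max 0 (r i - k i)" for i
    have z0: "0 \<le> z i" for i by (simp add: z_def)
    define Z where "Z = (\<Sum>i\<le>n. z i)"
    have Z0: "0 \<le> Z" unfolding Z_def by (intro sum_nonneg) (simp add: z0)
    show ?thesis
    proof (cases "Z = 0")
      case True
      then have "z i = 0" if "i \<le> n" for i
        using that z0 by (simp add: Z_def sum_nonneg_eq_0_iff)
      then have "J k = 0" by (simp add: J_def z_def)
      with m_le[OF k] Q_nonneg show ?thesis by (simp add: order_trans[of m 0])
    next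
      case False
      with Z0 have Z: "0 < Z" by simp
      have "(\<Sum>i\<le>n. z i / Z) = 1"
        using Z by (simp add: Z_def flip: sum_divide_distrib)
      then obtain k' where k': "k' \<in> K"
        and "(\<Sum>i\<le>n. z i / Z * r i) - s / Z \<le> (\<Sum>i\<le>n. z i / Z * k' i)"
        using opt[of "\<lambda>i. z i / Z" "s / Z"] z0 Z s by auto
      then have "Z * ((\<Sum>i\<le>n. z i / Z * r i) - s / Z) \<le> Z * (\<Sum>i\<le>n. z i / Z * k' i)"
        using Z by (intro mult_left_mono) auto
      then have "(\<Sum>i\<le>n. z i * r i) - s \<le> (\<Sum>i\<le>n. z i * k' i)"
        using Z by (simp add: right_diff_distrib sum_distrib_left)
      then have zk': "(\<Sum>i\<le>n. z i * (r i - k' i)) \<le> s"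
        by (simp add: right_diff_distrib sum_subtractf)
      from conv[OF k k', of s] s obtain k''
        where k'': "k'' \<in> K" "\<And>i. i \<le> n \<Longrightarrow> k'' i = (1 - s) * k i + s * k' i"
        by auto
      have "J k'' \<le> (\<Sum>i\<le>n. (1 - s)\<^sup>2 * (z i)\<^sup>2 + 2 * s * (1 - s) * (z i * (r i - k' i)) + s\<^sup>2 * (\<bar>r i\<bar> + D)\<^sup>2)"
        unfolding J_def
      proof (rule sum_mono)
        fix i assume "i \<in> {..n}"
        then have i: "i \<le> n" by simp
        have "(1 - s) * (r i - k i) \<le> (1 - s) * z i"
          using s by (intro mult_left_mono) (auto simp: z_def)
        then have "r i - k'' i \<le> (1 - s) * z i + s * (r i - k' i)"
          unfolding k''(2)[OF i] by (simp add: algebra_simps)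
        then have "(max 0 (r i - k'' i))\<^sup>2 \<le> ((1 - s) * z i + s * (r i - k' i))\<^sup>2"
          by (auto simp: max_def intro: power_mono)
        also have "\<dots> = (1 - s)\<^sup>2 * (z i)\<^sup>2 + 2 * s * (1 - s) * (z i * (r i - k' i)) + s\<^sup>2 * (r i - k' i)\<^sup>2"
          by (simp add: power2_eq_square algebra_simps)
        also have "(r i - k' i)\<^sup>2 \<le> (\<bar>r i\<bar> + D)\<^sup>2"
          using bound[OF k' i] by (intro abs_le_square_iff[THEN iffD1]) linarith
        finally show "(max 0 (r i - k'' i))\<^sup>2
            \<le> (1 - s)\<^sup>2 * (z i)\<^sup>2 + 2 * s * (1 - s) * (z i * (r i - k' i)) + s\<^sup>2 * (\<bar>r i\<bar> + D)\<^sup>2"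
          by (simp add: mult_left_mono)
      qed
      also have "\<dots> = (1 - s)\<^sup>2 * J k + 2 * s * (1 - s) * (\<Sum>i\<le>n. z i * (r i - k' i)) + s\<^sup>2 * Q"
        by (simp add: sum.distrib sum_distrib_left J_def Q_def z_def)
      also have "2 * s * (1 - s) * (\<Sum>i\<le>n. z i * (r i - k' i)) \<le> 2 * s * (1 - s) * s"
        using s zk' by (intro mult_left_mono) auto
      also have "2 * s * (1 - s) * s \<le> 2 * s\<^sup>2"
        using s by (simp add: power2_eq_square algebra_simps)
      finally show ?thesis
        using m_le[OF k''(1)] by (simp add: algebra_simps)
    qed
  qed
  \<comment> \<open>The infimum over \<open>k\<close> in \<open>step\<close> gives
    \<open>m \<le> (1 - s)\<^sup>2 * m + s\<^sup>2 * (Q + 2)\<close>; cancelling one factor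
    \<open>s\<close> bounds \<open>m\<close> by a multiple of \<open>s\<close>.\<close>
  have small: "m \<le> s * (Q + 2)" if s: "0 < s" "s < 1" for s
  proof -
    have p: "0 < (1 - s)\<^sup>2" using s by simp
    have "(m - s\<^sup>2 * (Q + 2)) / (1 - s)\<^sup>2 \<le> m"
      unfolding m_def
    proof (rule cInf_greatest)
      fix y assume "y \<in> J ` K"
      then obtain k where "k \<in> K" "y = J k" by auto
      with step[of k s] s p show "(Inf (J ` K) - s\<^sup>2 * (Q + 2)) / (1 - s)\<^sup>2 \<le> y"
        by (simp add: pos_divide_le_eq m_def mult.commute)
    qed (use ne in auto)
    then have "m - s\<^sup>2 * (Q + 2) \<le> m * (1 - s)\<^sup>2"
      using p by (simp add: pos_divide_le_eq)
    then have "s * (m * (2 - s)) \<le> s * (s * (Q + 2))"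
      by (simp add: power2_eq_square algebra_simps)
    then have "m * (2 - s) \<le> s * (Q + 2)"
      using s by simp
    moreover have "m * 1 \<le> m * (2 - s)"
      using s m_nonneg by (intro mult_left_mono) auto
    ultimately show ?thesis by simp
  qed
  have "m < e\<^sup>2"
  proof -
    define s where "s = min (1/2) (e\<^sup>2 / (2 * (Q + 2)))"
    have "0 < s" "s < 1" using e Q_nonneg by (auto simp: s_def)
    then have "m \<le> s * (Q + 2)" by (rule small)
    also have "\<dots> \<le> e\<^sup>2 / (2 * (Q + 2)) * (Q + 2)"
      using Q_nonneg by (intro mult_right_mono) (auto simp: s_def)
    also have "\<dots> = e\<^sup>2 / 2" using Q_nonneg by (simp add: divide_simps)
    also have "\<dots> < e\<^sup>2" using e by simp
    finally show ?thesis .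
  qed
  then obtain k where k: "k \<in> K" "J k < e\<^sup>2"
    unfolding m_def using cInf_less_iff[of "J ` K"] ne bdd by auto
  have "r i - e \<le> k i" if "i \<le> n" for i
  proof -
    have "(max 0 (r i - k i))\<^sup>2 \<le> J k"
      unfolding J_def by (rule member_le_sum[of i _ "\<lambda>i. (max 0 (r i - k i))\<^sup>2"]) (use that in auto)
    then have "(max 0 (r i - k i))\<^sup>2 < e\<^sup>2" using k by simp
    then have "max 0 (r i - k i) < e"
      using e by (meson less_imp_le power_less_imp_less_base)
    then show ?thesis by simp
  qed
  with k show ?thesis by blast
qed

text \<open>The array \<open>c\<close> serves two encodings: \<open>w\<close> may hold action
  probabilities, with \<open>c i j\<close> the utility of action \<open>j\<close> in state
  \<open>i\<close>, or utility profiles, with \<open>c\<close> the identity matrix. Domination up to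
  every positive error becomes exact because dominated convergence carries the inequalities to an
  almost everywhere limit.\<close>

lemma payoff_attained:
  fixes f :: "nat \<Rightarrow> 'a \<Rightarrow> real" and c :: "nat \<Rightarrow> 'j \<Rightarrow> real"
    and W :: "('j \<Rightarrow> 'a \<Rightarrow> real) set" and J :: "'j set" and M :: "'a measure"
  defines "P \<equiv> \<lambda>w i. \<integral>x. (\<Sum>j\<in>J. w j x * c i j) * f i x \<partial>M"
  assumes M: "finite_measure M" and J: "finite J"
    and f: "\<And>i. i \<le> n \<Longrightarrow> integrable M (f i)"
    and meas: "\<And>w j. w \<in> W \<Longrightarrow> j \<in> J \<Longrightarrow> w j \<in> borel_measurable M"
    and bound: "\<And>w j x. w \<in> W \<Longrightarrow> j \<in> J \<Longrightarrow> x \<in> space M \<Longrightarrow> \<bar>w j x\<bar> \<le> B"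
    and conv: "\<And>w w' s. w \<in> W \<Longrightarrow> w' \<in> W \<Longrightarrow> 0 \<le> s \<Longrightarrow> s \<le> 1 \<Longrightarrow>
      (\<lambda>j x. (1 - s) * w j x + s * w' j x) \<in> W"
    and lim: "\<And>v. (\<And>k. v k \<in> W) \<Longrightarrow> (\<And>j. j \<in> J \<Longrightarrow> AE x in M. convergent (\<lambda>k. v k j x)) \<Longrightarrow>
      \<exists>w\<in>W. \<forall>j\<in>J. AE x in M. (\<lambda>k. v k j x) \<longlonglongrightarrow> w j x"
    and opt: "\<And>l e. (\<And>i. i \<le> n \<Longrightarrow> 0 \<le> l i) \<Longrightarrow> (\<Sum>i\<le>n. l i) = 1 \<Longrightarrow> 0 < e \<Longrightarrow>
      \<exists>w\<in>W. (\<Sum>i\<le>n. l i * r i) - e \<le> (\<Sum>i\<le>n. l i * P w i)"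
  shows "\<exists>w\<in>W. \<forall>i\<le>n. r i \<le> P w i"
proof -
  define S where "S i = (\<Sum>j\<in>J. B * \<bar>c i j\<bar>)" for i
  have pw: "\<bar>(\<Sum>j\<in>J. w j x * c i j) * f i x\<bar> \<le> S i * \<bar>f i x\<bar>"
    if "w \<in> W" "x \<in> space M" for w x i
  proof -
    have "\<bar>\<Sum>j\<in>J. w j x * c i j\<bar> \<le> (\<Sum>j\<in>J. \<bar>w j x * c i j\<bar>)" by (rule sum_abs)
    also have "\<dots> \<le> S i"
      unfolding S_def by (rule sum_mono) (use bound[OF that(1) _ that(2)] in \<open>auto simp: abs_mult intro: mult_right_mono\<close>)
    finally show ?thesis by (simp add: abs_mult mult_right_mono)
  qed
  have pm: "(\<lambda>x. (\<Sum>j\<in>J. w j x * c i j) * f i x) \<in> borel_measurable M"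
    if "w \<in> W" "i \<le> n" for w i
    by (intro borel_measurable_times borel_measurable_sum meas[OF that(1)] borel_measurable_const
        borel_measurable_integrable[OF f[OF that(2)]])
  have pi: "integrable M (\<lambda>x. (\<Sum>j\<in>J. w j x * c i j) * f i x)" if "w \<in> W" "i \<le> n" for w i
  proof (rule Bochner_Integration.integrable_bound[of _ "\<lambda>x. S i * f i x"])
    show "AE x in M. norm ((\<Sum>j\<in>J. w j x * c i j) * f i x) \<le> norm (S i * f i x)"
      by (intro AE_I2) (use pw[OF that(1)] in \<open>auto simp: abs_mult intro: order_trans[OF _ mult_right_mono[OF abs_ge_self]]\<close>)
  qed (use f[OF that(2)] pm[OF that] in auto)
  have P_bound: "\<bar>P w i\<bar> \<le> S i * (\<integral>x. \<bar>f i x\<bar> \<partial>M)" if "w \<in> W" "i \<le> n" for w i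
  proof -
    have "\<bar>P w i\<bar> \<le> (\<integral>x. \<bar>(\<Sum>j\<in>J. w j x * c i j) * f i x\<bar> \<partial>M)"
      unfolding P_def by (rule integral_abs_bound)
    also have "\<dots> \<le> (\<integral>x. S i * \<bar>f i x\<bar> \<partial>M)"
      by (rule integral_mono) (use pi[OF that] f[OF that(2)] pw[OF that(1)] in auto)
    finally show ?thesis by simp
  qed
  have P_conv: "P (\<lambda>j x. (1 - s) * w j x + s * w' j x) i = (1 - s) * P w i + s * P w' i"
    if "w \<in> W" "w' \<in> W" "i \<le> n" for w w' i s
  proof -
    have "P (\<lambda>j x. (1 - s) * w j x + s * w' j x) i
      = (\<integral>x. (1 - s) * ((\<Sum>j\<in>J. w j x * c i j) * f i x) + s * ((\<Sum>j\<in>J. w' j x * c i j) * f i x) \<partial>M)"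
      unfolding P_def
      by (rule Bochner_Integration.integral_cong)
        (auto simp: sum.distrib sum_distrib_left sum_distrib_right distrib_left distrib_right
            mult.assoc mult.left_commute)
    also have "\<dots> = (1 - s) * P w i + s * P w' i"
      unfolding P_def using pi[OF that(1,3)] pi[OF that(2,3)] by simp
    finally show ?thesis .
  qed
  define Dm where "Dm = (\<Sum>i\<le>n. \<bar>S i * (\<integral>x. \<bar>f i x\<bar> \<partial>M)\<bar>)"
  have approx: "\<exists>k\<in>P ` W. \<forall>i\<le>n. r i - e \<le> k i" if "0 < e" for e
  proof (rule approx_dominating_vector[OF _ _ _ that])
    fix k i assume "k \<in> P ` W" "i \<le> n"
    then have "\<bar>k i\<bar> \<le> \<bar>S i * (\<integral>x. \<bar>f i x\<bar> \<partial>M)\<bar>"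
      using P_bound by (auto intro: order_trans[OF _ abs_ge_self])
    also have "\<dots> \<le> Dm" unfolding Dm_def
      by (rule member_le_sum[of i _ "\<lambda>i. \<bar>S i * (\<integral>x. \<bar>f i x\<bar> \<partial>M)\<bar>"]) (use \<open>i \<le> n\<close> in auto)
    finally show "\<bar>k i\<bar> \<le> Dm" .
  next
    fix k k' and s :: real assume "k \<in> P ` W" "k' \<in> P ` W" and s: "0 \<le> s" "s \<le> 1"
    then obtain w w' where "w \<in> W" "w' \<in> W" "k = P w" "k' = P w'" by auto
    then show "\<exists>k''\<in>P ` W. \<forall>i\<le>n. k'' i = (1 - s) * k i + s * k' i"
      using conv[of w w' s] s P_conv[of w w' _ s]
      by (intro bexI[of _ "P (\<lambda>j x. (1 - s) * w j x + s * w' j x)"]) auto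
  next
    fix l :: "nat \<Rightarrow> real" and e :: real
    assume "\<And>i. i \<le> n \<Longrightarrow> 0 \<le> l i" "(\<Sum>i\<le>n. l i) = 1" "0 < e"
    from opt[OF this] show "\<exists>k\<in>P ` W. (\<Sum>i\<le>n. l i * r i) - e \<le> (\<Sum>i\<le>n. l i * k i)"
      by auto
  qed
  define e where "e k = 1 / real (Suc k)" for k
  \<comment> \<open>These sets inherit midpoints from \<open>W\<close> because \<open>P\<close> is
    affine along segments, and they shrink with the tolerance \<open>e k\<close>.\<close>
  define V where "V k = {w\<in>W. \<forall>i\<le>n. r i - e k \<le> P w i}" for k
  have e_mono: "e (Suc k) \<le> e k" for k by (simp add: e_def frac_le)
  obtain v where v: "\<And>k. v k \<in> V k" "\<And>j. j \<in> J \<Longrightarrow> AE x in M. convergent (\<lambda>k. v k j x)"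
  proof (rule decreasing_convex_AE_limit[OF M J, of V B])
    show "V k \<noteq> {}" for k
      using approx[of "e k"] by (auto simp: V_def e_def)
    show "V (Suc k) \<subseteq> V k" for k
      using e_mono[of k] unfolding V_def by (auto intro: order_trans[OF diff_left_mono])
    show "(\<lambda>j x. (w j x + w' j x) / 2) \<in> V k" if "w \<in> V k" "w' \<in> V k" for k w w'
    proof -
      have w: "w \<in> W" "w' \<in> W" using that by (auto simp: V_def)
      have eq: "(\<lambda>j x. (w j x + w' j x) / 2) = (\<lambda>j x. (1 - 1/2) * w j x + 1/2 * w' j x)"
        by (simp add: fun_eq_iff field_simps)
      have "r i - e k \<le> (1 - 1/2) * P w i + 1/2 * P w' i" if "i \<le> n" for i
        using \<open>w \<in> V k\<close> \<open>w' \<in> V k\<close> that unfolding V_def by (auto simp: field_simps dest!: spec[of _ i])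
      then show ?thesis
        unfolding eq V_def using conv[OF w, of "1/2"] P_conv[OF w, of _ "1/2"] by auto
    qed
  qed (auto simp: V_def intro: meas bound)
  have vW: "v k \<in> W" for k using v(1) by (auto simp: V_def)
  from lim[OF vW v(2)] obtain w where w: "w \<in> W" "\<And>j. j \<in> J \<Longrightarrow> AE x in M. (\<lambda>k. v k j x) \<longlonglongrightarrow> w j x"
    by auto
  have "r i \<le> P w i" if i: "i \<le> n" for i
  proof (rule LIMSEQ_le)
    have "AE x in M. \<forall>j\<in>J. (\<lambda>k. v k j x) \<longlonglongrightarrow> w j x"
      using w(2) J by (intro AE_finite_allI) auto
    then have "AE x in M. (\<lambda>k. (\<Sum>j\<in>J. v k j x * c i j) * f i x) \<longlonglongrightarrow> (\<Sum>j\<in>J. w j x * c i j) * f i x"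
      by (rule AE_mp) (auto intro!: AE_I2 tendsto_intros)
    then show "(\<lambda>k. P (v k) i) \<longlonglongrightarrow> P w i"
      unfolding P_def
      by (intro integral_dominated_convergence[where w="\<lambda>x. S i * \<bar>f i x\<bar>"])
        (use pm[OF w(1) i] pm[OF vW i] f[OF i] pw[OF vW] in auto)
    have "(\<lambda>k. r i - e k) \<longlonglongrightarrow> r i - 0"
      unfolding e_def using LIMSEQ_inverse_real_of_nat
      by (intro tendsto_intros) (simp add: inverse_eq_divide)
    then show "(\<lambda>k. r i - e k) \<longlonglongrightarrow> r i" by simp
    show "\<exists>N. \<forall>k\<ge>N. r i - e k \<le> P (v k) i"
      using v(1) i by (auto simp: V_def)
  qed
  with w(1) show ?thesis by blast
qed

subsection \<open>Quasi-concavity and one-dimensional minimax\<close>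

text \<open>A subsequence of dominating actions converges in \<open>K\<close>, and continuity
  carries the inequalities to its limit.\<close>

lemma dominated_profile_limit:
  fixes u :: "real \<Rightarrow> nat \<Rightarrow> real"
  assumes K: "compact K" and u: "\<And>i. i \<le> n \<Longrightarrow> continuous_on K (\<lambda>a. u a i)"
    and w: "\<And>k. \<exists>a\<in>K. \<forall>i\<le>n. w k i \<le> u a i" and wl: "\<And>i. i \<le> n \<Longrightarrow> (\<lambda>k. w k i) \<longlonglongrightarrow> l i"
  shows "\<exists>a\<in>K. \<forall>i\<le>n. l i \<le> u a i"
proof -
  obtain a where a: "\<And>k. a k \<in> K" "\<And>k i. i \<le> n \<Longrightarrow> w k i \<le> u (a k) i"
    using w by metis
  obtain b r where b: "b \<in> K" "strict_mono (r :: nat \<Rightarrow> nat)" "(a \<circ> r) \<longlonglongrightarrow> b"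
    using K a(1) unfolding compact_def by metis
  have "l i \<le> u b i" if i: "i \<le> n" for i
  proof (rule LIMSEQ_le)
    show "(\<lambda>k. w (r k) i) \<longlonglongrightarrow> l i"
      using LIMSEQ_subseq_LIMSEQ[OF wl[OF i] b(2)] by (simp add: o_def)
    show "(\<lambda>k. u (a (r k)) i) \<longlonglongrightarrow> u b i"
      by (rule continuous_on_tendsto_compose[OF u[OF i] b(3)[unfolded o_def] b(1)]) (simp add: a(1))
    show "\<exists>N. \<forall>k\<ge>N. w (r k) i \<le> u (a (r k)) i"
      using a(2)[OF i] by blast
  qed
  with b(1) show ?thesis by blast
qed

text \<open>Closedness makes this set of profiles Borel, which is needed to select a dominating
  action measurably. Convergence in the product topology is coordinatewise, so the previous lemma
  applies.\<close>

lemma closed_dominated_profiles: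
  fixes u :: "real \<Rightarrow> nat \<Rightarrow> real"
  assumes K: "compact K" and u: "\<And>i. i \<le> n \<Longrightarrow> continuous_on K (\<lambda>a. u a i)"
  shows "closed {w :: nat \<Rightarrow> real. \<exists>a\<in>K. \<forall>i\<le>n. w i \<le> u a i}"
  unfolding closed_sequential_limits
proof (intro allI impI, elim conjE)
  fix w :: "nat \<Rightarrow> nat \<Rightarrow> real" and l
  assume w: "\<forall>k. w k \<in> {w. \<exists>a\<in>K. \<forall>i\<le>n. w i \<le> u a i}" and wl: "w \<longlonglongrightarrow> l"
  have wli: "(\<lambda>k. w k i) \<longlonglongrightarrow> l i" for i
  proof -
    have "isCont (\<lambda>x :: nat \<Rightarrow> real. x i) l"
      using continuous_on_product_coordinates[where i=i]
      by (rule continuous_on_interior) simp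
    then show ?thesis using wl by (rule isCont_tendsto_compose)
  qed
  have "\<exists>a\<in>K. \<forall>i\<le>n. l i \<le> u a i"
    by (rule dominated_profile_limit[OF K u _ wli]) (use w in auto)
  then show "l \<in> {w. \<exists>a\<in>K. \<forall>i\<le>n. w i \<le> u a i}" by simp
qed

lemma quasiconcave_onD:
  assumes h: "quasiconcave_on A h" and A: "x \<in> A" "y \<in> A" "z \<in> A" and z: "x \<le> z" "z \<le> y"
  shows "min (h x) (h y) \<le> h z"
proof (cases "x = y")
  case True
  with z show ?thesis by simp
next
  case False
  with z have xy: "x < y" by simp
  define t where "t = (z - x) / (y - x)"
  have t: "t \<in> {0..1}" using z xy by (simp add: t_def field_simps)
  have "t * (y - x) = z - x" using xy by (simp add: t_def)
  then have "(1 - t) * x + t * y = z" by (simp add: algebra_simps)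
  then show ?thesis using h A t unfolding quasiconcave_on_def by metis
qed

lemma quasiconcave_onI:
  assumes "\<And>x y z. x \<in> A \<Longrightarrow> y \<in> A \<Longrightarrow> z \<in> A \<Longrightarrow> x \<le> z \<Longrightarrow> z \<le> y \<Longrightarrow> min (h x) (h y) \<le> h z"
  shows "quasiconcave_on A h"
  unfolding quasiconcave_on_def
proof (intro ballI impI)
  fix x y t :: real
  assume A: "x \<in> A" "y \<in> A" "(1 - t) * x + t * y \<in> A" and t: "t \<in> {0..1}"
  let ?z = "(1 - t) * x + t * y"
  show "min (h x) (h y) \<le> h ?z"
  proof (cases "x \<le> y")
    case True
    have "0 \<le> t * (y - x)" "0 \<le> (1 - t) * (y - x)" using True t by simp_all
    then have "x \<le> ?z" "?z \<le> y" by (simp_all add: algebra_simps)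
    then show ?thesis using assms[OF A] by blast
  next
    case False
    then have "0 \<le> t * (x - y)" "0 \<le> (1 - t) * (x - y)" using t by simp_all
    then have "?z \<le> x" "y \<le> ?z" by (simp_all add: algebra_simps)
    then show ?thesis using assms[OF A(2,1,3)] by (simp add: min.commute)
  qed
qed

lemma connected_closed_cover:
  assumes "connected S" "closed A" "closed B" "S \<subseteq> A \<union> B" "A \<inter> S \<noteq> {}" "B \<inter> S \<noteq> {}"
  shows "A \<inter> B \<inter> S \<noteq> {}"
  using assms unfolding connected_closed by blast

text \<open>A one-dimensional minimax argument in the style of Sion: the superlevel sets are intervals,
  so a common point exists as soon as any two of them meet.\<close>

lemma ex_nonneg_profile:
  fixes v :: "real \<Rightarrow> nat \<Rightarrow> real"
  assumes cont: "\<And>i. i \<le> n \<Longrightarrow> continuous_on {c..d} (\<lambda>a. v a i)"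
    and qc: "\<And>i j t. i \<le> n \<Longrightarrow> j \<le> n \<Longrightarrow> 0 \<le> t \<Longrightarrow> t \<le> 1 \<Longrightarrow>
      quasiconcave_on {c..d} (\<lambda>a. (1 - t) * v a i + t * v a j)"
    and nonneg: "\<And>i j t. i \<le> n \<Longrightarrow> j \<le> n \<Longrightarrow> 0 \<le> t \<Longrightarrow> t \<le> 1 \<Longrightarrow>
      \<exists>a\<in>{c..d}. 0 \<le> (1 - t) * v a i + t * v a j"
  shows "\<exists>a\<in>{c..d}. \<forall>i\<le>n. 0 \<le> v a i"
proof -
  define I where "I i = {c..d} \<inter> (\<lambda>a. v a i) -` {0..}" for i
  have I_closed: "closed (I i)" if "i \<le> n" for i
    unfolding I_def by (rule continuous_closed_preimage) (use cont that in auto)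
  have I_sub: "I i \<subseteq> {c..d}" for i by (auto simp: I_def)
  have I_compact: "compact (I i)" if "i \<le> n" for i
    using compact_Int_closed[OF compact_Icc I_closed[OF that], of c d] I_sub by (simp add: Int_absorb1)
  \<comment> \<open>Two connectedness arguments. The sets \<open>T i\<close> and \<open>T j\<close>
    collect the weights \<open>t\<close> for which the mixture \<open>h t\<close> is nonnegative
    somewhere on \<open>I i\<close> or on \<open>I j\<close>; they are closed and cover the unit
    interval, hence share some \<open>t\<close>. For this \<open>t\<close> quasi-concavity keeps
    \<open>h t\<close> nonnegative on the whole segment between the two witnesses, so
    \<open>I i\<close> and \<open>I j\<close> cover that segment and must meet.\<close>
  have meet: "I i \<inter> I j \<noteq> {}" if ij: "i \<le> n" "j \<le> n" for i j
  proof
    assume disj: "I i \<inter> I j = {}"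
    define h where "h t a = (1 - t) * v a i + t * v a j" for t a
    define T where "T k = fst ` (({0..1} \<times> I k) \<inter> (\<lambda>p. h (fst p) (snd p)) -` {0..})" for k
    have T_iff: "t \<in> T k \<longleftrightarrow> 0 \<le> t \<and> t \<le> 1 \<and> (\<exists>a\<in>I k. 0 \<le> h t a)" for t k
      by (force simp: T_def)
    have T_closed: "closed (T k)" if k: "k \<le> n" for k
    proof -
      have c: "continuous_on ({0..1} \<times> I k) (\<lambda>p. v (snd p) l)" if "l \<le> n" for l
        by (rule continuous_on_compose2[OF cont[OF that]])
          (use I_sub[of k] in \<open>auto intro!: continuous_intros\<close>)
      have "compact ({0..1::real} \<times> I k)"
        using I_compact[OF k] by (intro compact_Times) auto
      moreover have "closed (({0..1} \<times> I k) \<inter> (\<lambda>p. h (fst p) (snd p)) -` {0..})"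
        unfolding h_def
        by (intro continuous_closed_preimage continuous_intros c ij closed_Times I_closed k)
      ultimately have "compact (({0..1} \<times> I k) \<inter> (\<lambda>p. h (fst p) (snd p)) -` {0..})"
        by (metis compact_Int_closed inf.right_idem inf_commute)
      then show ?thesis
        unfolding T_def by (intro compact_imp_closed compact_continuous_image continuous_intros)
    qed
    have split: "a \<in> I i \<or> a \<in> I j" if "a \<in> {c..d}" "0 \<le> h t a" "0 \<le> t" "t \<le> 1" for a t
    proof (rule ccontr)
      assume "\<not> (a \<in> I i \<or> a \<in> I j)"
      then have "v a i < 0" "v a j < 0" using that by (auto simp: I_def)
      then have "(1 - t) * v a i + t * v a j < 0"
        using that by (cases "t = 0") (auto intro!: add_nonpos_neg mult_nonneg_nonpos mult_pos_neg)
      with that show False by (simp add: h_def)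
    qed
    have "T i \<inter> T j \<inter> {0..1} \<noteq> {}"
    proof (rule connected_closed_cover)
      show "{0..1} \<subseteq> T i \<union> T j"
      proof
        fix t :: real assume "t \<in> {0..1}"
        then have t: "0 \<le> t" "t \<le> 1" by auto
        obtain a where a: "a \<in> {c..d}" "0 \<le> h t a" using nonneg[OF ij t] unfolding h_def by blast
        from split[OF a t] show "t \<in> T i \<union> T j"
          unfolding Un_iff T_iff using t a(2) by blast
      qed
      have "0 \<in> T i" using nonneg[OF ij(1,1), of 0] by (auto simp: T_iff h_def I_def)
      then show "T i \<inter> {0..1} \<noteq> {}" by (metis IntI T_iff atLeastAtMost_iff empty_iff)
      have "1 \<in> T j" using nonneg[OF ij(2,2), of 0] by (auto simp: T_iff h_def I_def)
      then show "T j \<inter> {0..1} \<noteq> {}" by (metis IntI T_iff atLeastAtMost_iff empty_iff)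
    qed (use T_closed ij in auto)
    then obtain t a b where t: "0 \<le> t" "t \<le> 1" and ab: "a \<in> I i" "b \<in> I j" "0 \<le> h t a" "0 \<le> h t b"
      by (auto simp: T_iff)
    have seg: "{min a b..max a b} \<subseteq> I i \<union> I j"
    proof
      fix z assume z: "z \<in> {min a b..max a b}"
      have mem: "a \<in> {c..d}" "b \<in> {c..d}" using ab I_sub by blast+
      then have zc: "z \<in> {c..d}" using z by auto
      have qh: "quasiconcave_on {c..d} (h t)"
        using qc[OF ij t] by (simp add: h_def[abs_def])
      have "a \<le> z \<and> z \<le> b \<or> b \<le> z \<and> z \<le> a" using z by auto
      then have "0 \<le> h t z"
        using quasiconcave_onD[OF qh mem(1,2) zc] quasiconcave_onD[OF qh mem(2,1) zc] ab(3,4) by linarith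
      with split[OF zc _ t] show "z \<in> I i \<union> I j" by auto
    qed
    have "a \<in> I i \<inter> {min a b..max a b}" "b \<in> I j \<inter> {min a b..max a b}" using ab by simp_all
    then have "I i \<inter> I j \<inter> {min a b..max a b} \<noteq> {}"
      using connected_closed_cover[OF connected_Icc I_closed[OF ij(1)] I_closed[OF ij(2)] seg] by blast
    with disj show False by simp
  qed
  have "\<exists>x\<in>I i. \<forall>y\<in>I i. x \<le> y" if "i \<le> n" for i
    using compact_attains_inf[OF I_compact[OF that]] meet[OF that that] by simp
  then obtain m where m: "\<And>i. i \<le> n \<Longrightarrow> m i \<in> I i" "\<And>i y. i \<le> n \<Longrightarrow> y \<in> I i \<Longrightarrow> m i \<le> y"
    by metis
  \<comment> \<open>Helly's theorem on the line: the largest of the left endpoints of pairwise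
    intersecting intervals belongs to all of them.\<close>
  define a where "a = Max (m ` {..n})"
  have "a \<in> m ` {..n}" unfolding a_def by (rule Max_in) auto
  then obtain i where i: "i \<le> n" "a = m i" by auto
  have aI: "a \<in> I j" if j: "j \<le> n" for j
  proof -
    obtain z where z: "z \<in> I i" "z \<in> I j" using meet[OF i(1) j] by auto
    have "m j \<le> a" unfolding a_def by (rule Max_ge) (use j in auto)
    moreover have "a \<le> z" using m(2)[OF i(1) z(1)] i(2) by simp
    ultimately have le: "m j \<le> a" "a \<le> z" .
    have "min (v (m j) j) (v z j) \<le> v a j"
      using quasiconcave_onD[OF qc[OF j j, of 0], of "m j" z a] m(1)[OF j] m(1)[OF i(1)] z i le
      by (auto simp: I_def)
    then show ?thesis using m(1)[OF j] m(1)[OF i(1)] z i by (auto simp: I_def)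
  qed
  then show ?thesis using aI[of 0] by (intro bexI[of _ a]) (auto simp: I_def)
qed

section \<open>Tangents of convex functions, measurable maximisers and finite grids\<close>

lemma convex_subgradients:
  fixes C :: "real \<Rightarrow> real"
  assumes "convex_on UNIV C"
  obtains s where "\<And>x y. C x + s x * (y - x) \<le> C y"
proof
  fix x y
  show "C x + Inf ((\<lambda>t. (C x - C t) / (x - t)) ` ({x<..} \<inter> UNIV)) * (y - x) \<le> C y"
    using convex_le_Inf_differential[OF assms, of x y] by simp
qed

text \<open>Each tangent is exact at its own point of contact, so the open sets on which one tangent
  is within \<open>e\<close> of \<open>C\<close> cover the compact interval, and finitely many of
  them suffice.\<close>

lemma convex_approx_tangents:
  fixes C :: "real \<Rightarrow> real"
  assumes C: "convex_on UNIV C" and s: "\<And>x y. C x + s x * (y - x) \<le> C y" and e: "0 < e"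
  obtains B where "finite B" "B \<noteq> {}" "\<And>t. \<bar>t\<bar> \<le> R \<Longrightarrow> \<exists>a\<in>B. C t - e \<le> C a + s a * (t - a)"
proof -
  have cont: "continuous_on UNIV C" using convex_on_continuous[OF open_UNIV C] .
  have op: "open {t. C t - (C a + s a * (t - a)) < e}" for a
    by (intro open_Collect_less continuous_intros cont)
  have cov: "{-R..R} \<subseteq> (\<Union>a\<in>UNIV. {t. C t - (C a + s a * (t - a)) < e})"
  proof
    fix x show "x \<in> (\<Union>a\<in>UNIV. {t. C t - (C a + s a * (t - a)) < e})"
      by (rule UN_I[of x]) (use e in simp_all)
  qed
  obtain B where B: "finite B" "{-R..R} \<subseteq> (\<Union>a\<in>B. {t. C t - (C a + s a * (t - a)) < e})"
    by (rule compactE_image[OF compact_Icc op cov])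
  show ?thesis
  \<comment> \<open>For negative \<open>R\<close> the subcover may be empty; the extra point
    \<open>0\<close> guarantees at least one tangent.\<close>
  proof (rule that[of "insert 0 B"])
    fix t :: real assume "\<bar>t\<bar> \<le> R"
    then have "t \<in> {-R..R}" by auto
    with B(2) obtain a where a: "a \<in> B" "C t - (C a + s a * (t - a)) < e" by blast
    then have "C t - e \<le> C a + s a * (t - a)" by linarith
    with a(1) show "\<exists>a\<in>insert 0 B. C t - e \<le> C a + s a * (t - a)" by blast
  qed (use B(1) in auto)
qed

text \<open>The index type carries no sigma-algebra, so measurability of the selection
  \<open>s\<close> is expressed by its effect: evaluating any measurable family at \<open>s\<close>
  gives a measurable function. The induction switches to a new index exactly where it does at least
  as well as the old maximiser.\<close>

lemma measurable_argmax:
  fixes p :: "'b \<Rightarrow> 'a \<Rightarrow> real"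
  assumes "finite B" "B \<noteq> {}" "\<forall>b\<in>B. p b \<in> borel_measurable M"
  shows "\<exists>s. (\<forall>x. s x \<in> B) \<and> (\<forall>b\<in>B. \<forall>x. p b x \<le> p (s x) x) \<and>
    (\<forall>q :: 'b \<Rightarrow> 'a \<Rightarrow> real. (\<forall>b\<in>B. q b \<in> borel_measurable M) \<longrightarrow> (\<lambda>x. q (s x) x) \<in> borel_measurable M)"
  using assms
proof (induction B rule: finite_ne_induct)
  case (singleton b)
  show ?case by (rule exI[of _ "\<lambda>x. b"]) simp
next
  case (insert b B)
  have "\<forall>b\<in>B. p b \<in> borel_measurable M" using insert.prems by simp
  from insert.IH[OF this] obtain s where s: "\<And>x. s x \<in> B" "\<And>b x. b \<in> B \<Longrightarrow> p b x \<le> p (s x) x"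
    "\<And>q :: 'b \<Rightarrow> 'a \<Rightarrow> real. \<forall>b\<in>B. q b \<in> borel_measurable M \<Longrightarrow> (\<lambda>x. q (s x) x) \<in> borel_measurable M"
    by (elim exE conjE) blast
  define s' where "s' x = (if p (s x) x \<le> p b x then b else s x)" for x
  have ps: "(\<lambda>x. p (s x) x) \<in> borel_measurable M" and pb: "p b \<in> borel_measurable M"
    using s(3)[of p] insert.prems by auto
  have "(\<lambda>x. q (s' x) x) \<in> borel_measurable M"
    if q: "\<forall>b'\<in>insert b B. q b' \<in> borel_measurable M" for q :: "'b \<Rightarrow> 'a \<Rightarrow> real"
  proof -
    have eq: "(\<lambda>x. q (s' x) x) = (\<lambda>x. if p (s x) x \<le> p b x then q b x else q (s x) x)"
      by (auto simp: s'_def)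
    show ?thesis
      unfolding eq using s(3)[of q] q ps pb by (intro measurable_If borel_measurable_le) auto
  qed
  moreover have "s' x \<in> insert b B" for x using s(1) by (simp add: s'_def)
  moreover have "p b' x \<le> p (s' x) x" if "b' \<in> insert b B" for b' x
  proof (cases "b' = b")
    case True
    then show ?thesis by (simp add: s'_def)
  next
    case False
    with that have "p b' x \<le> p (s x) x" using s(2) by simp
    then show ?thesis by (simp add: s'_def)
  qed
  ultimately show ?case by (intro exI[of _ s']) blast
qed

text \<open>Continuity of the finitely many state utilities gives each action a common radius; a
  finite subcover by such balls yields the grid.\<close>

lemma compact_finite_grid:
  fixes u :: "real \<Rightarrow> nat \<Rightarrow> real"
  assumes A: "compact A" "A \<noteq> {}" and u: "\<And>i. i \<le> n \<Longrightarrow> continuous_on A (\<lambda>a. u a i)" and e: "0 < e"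
  obtains B where "finite B" "B \<noteq> {}" "B \<subseteq> A" "\<forall>a\<in>A. \<exists>b\<in>B. \<forall>i\<le>n. \<bar>u a i - u b i\<bar> \<le> e"
proof -
  have "\<exists>d>0. \<forall>b\<in>A. dist b a < d \<longrightarrow> (\<forall>i\<le>n. \<bar>u b i - u a i\<bar> \<le> e)" if a: "a \<in> A" for a
  proof -
    have "\<exists>d>0. \<forall>b\<in>A. dist b a < d \<longrightarrow> \<bar>u b i - u a i\<bar> < e" if "i \<le> n" for i
      using u[OF that] a e unfolding continuous_on_iff dist_real_def by blast
    then obtain d where d: "\<And>i. i \<le> n \<Longrightarrow> 0 < d i"
      "\<And>i b. i \<le> n \<Longrightarrow> b \<in> A \<Longrightarrow> dist b a < d i \<Longrightarrow> \<bar>u b i - u a i\<bar> < e"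
      by metis
    have "0 < Min (d ` {..n})" using d(1) by (subst Min_gr_iff) auto
    moreover have "Min (d ` {..n}) \<le> d i" if "i \<le> n" for i using that by (intro Min_le) auto
    ultimately show ?thesis
      using d(2) by (meson less_imp_le order_less_le_trans)
  qed
  then obtain d where d: "\<And>a. a \<in> A \<Longrightarrow> 0 < d a"
    "\<And>a b i. a \<in> A \<Longrightarrow> b \<in> A \<Longrightarrow> dist b a < d a \<Longrightarrow> i \<le> n \<Longrightarrow> \<bar>u b i - u a i\<bar> \<le> e"
    by metis
  have "A \<subseteq> (\<Union>a\<in>A. ball a (d a))" using d(1) by auto
  then obtain B where B: "B \<subseteq> A" "finite B" "A \<subseteq> (\<Union>a\<in>B. ball a (d a))"
    using compactE_image[OF A(1), of A "\<lambda>a. ball a (d a)"] by (metis open_ball)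
  show ?thesis
  proof (rule that[OF B(2) _ B(1)])
    show "B \<noteq> {}" using B A by auto
    show "\<forall>a\<in>A. \<exists>b\<in>B. \<forall>i\<le>n. \<bar>u a i - u b i\<bar> \<le> e"
    proof
      fix a assume a: "a \<in> A"
      then obtain b where b: "b \<in> B" "dist a b < d b" using B(3) by (auto simp: dist_commute)
      then show "\<exists>b\<in>B. \<forall>i\<le>n. \<bar>u a i - u b i\<bar> \<le> e" using d(2)[of b a] a B(1) by blast
    qed
  qed
qed

subsection \<open>Beliefs and decision problems\<close>

lemma full_belief_nonneg: "q \<in> belief_simplex n \<Longrightarrow> i \<le> n \<Longrightarrow> 0 \<le> full_belief n q i"
  by (auto simp: full_belief_def belief_simplex_def)

lemma full_belief_sum: "(\<Sum>i\<le>n. full_belief n q i) = 1"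
proof -
  have "(\<Sum>i\<le>n. full_belief n q i) = full_belief n q 0 + (\<Sum>i=1..n. full_belief n q i)"
    by (simp add: sum.atLeast_Suc_atMost flip: atLeast0AtMost)
  also have "(\<Sum>i=1..n. full_belief n q i) = (\<Sum>i=1..n. q i)"
    by (rule sum.cong) (auto simp: full_belief_def)
  finally show ?thesis by (simp add: full_belief_def)
qed

text \<open>Weights on all states \<open>0..n\<close> are themselves a belief: the entry at
  \<open>0\<close> is ignored by \<open>belief_simplex\<close> and recovered by
  \<open>full_belief\<close> as the remaining mass.\<close>

lemma full_belief_weights:
  assumes "\<And>i. i \<le> n \<Longrightarrow> 0 \<le> l i" "(\<Sum>i\<le>n. l i) = 1"
  shows "l \<in> belief_simplex n" "\<And>i. full_belief n l i = l i"
proof -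
  have s: "l 0 + (\<Sum>i=1..n. l i) = 1"
    using assms(2) by (simp add: sum.atLeast_Suc_atMost flip: atLeast0AtMost)
  have le1: "(\<Sum>i=1..n. l i) \<le> 1" using s assms(1)[of 0] by simp
  have "l i \<le> (\<Sum>i=1..n. l i)" if "i \<in> {1..n}" for i
    by (rule member_le_sum) (use that assms(1) in auto)
  then have "0 \<le> l i \<and> l i \<le> 1" if "i \<in> {1..n}" for i
    using that le1 assms(1)[of i] by (meson atLeastAtMost_iff order_trans)
  with le1 show "l \<in> belief_simplex n" unfolding belief_simplex_def by blast
  show "full_belief n l i = l i" for i
    using s by (simp add: full_belief_def)
qed

text \<open>Eliminating the mass on state 0 leaves a constant plus a linear form in
  \<open>p 1, ..., p n\<close>, the kind of form to which linear-convex dominance applies.\<close>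

lemma exp_util_affine:
  "exp_util n u a p = u a 0 + (\<Sum>i=1..n. (u a i - u a 0) * p i)"
proof -
  have "exp_util n u a p = full_belief n p 0 * u a 0 + (\<Sum>i=1..n. full_belief n p i * u a i)"
    unfolding exp_util_def by (simp add: sum.atLeast_Suc_atMost)
  also have "(\<Sum>i=1..n. full_belief n p i * u a i) = (\<Sum>i=1..n. p i * u a i)"
    by (rule sum.cong) (auto simp: full_belief_def)
  finally show ?thesis
    by (simp add: full_belief_def algebra_simps sum_subtractf sum_distrib_left sum_distrib_right)
qed

lemma exp_util_le:
  assumes p: "p \<in> belief_simplex n" and le: "\<And>i. i \<le> n \<Longrightarrow> u a i \<le> w b i + e"
  shows "exp_util n u a p \<le> exp_util n w b p + e"
proof -
  have "exp_util n u a p \<le> (\<Sum>i\<le>n. full_belief n p i * (w b i + e))"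
    unfolding exp_util_def atLeast0AtMost
    by (intro sum_mono mult_left_mono le full_belief_nonneg[OF p]) auto
  also have "\<dots> = exp_util n w b p + (\<Sum>i\<le>n. full_belief n p i) * e"
    by (simp add: exp_util_def atLeast0AtMost distrib_left sum.distrib sum_distrib_right)
  finally show ?thesis by (simp add: full_belief_sum)
qed

lemma exp_util_const: "exp_util n (\<lambda>a i. c) a p = c"
  by (simp add: exp_util_affine)

text \<open>A common framework for interval problems, finite problems and finite subproblems of
  either, since every function on a finite set of reals is continuous.\<close>

locale continuous_problem =
  fixes n :: nat and A :: "real set" and u :: "real \<Rightarrow> nat \<Rightarrow> real"
  assumes compact: "compact A" and nonempty: "A \<noteq> {}"
    and cont: "\<And>i. i \<le> n \<Longrightarrow> continuous_on A (\<lambda>a. u a i)"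
begin

lemma bounded_util: "\<exists>D. \<forall>a\<in>A. \<forall>i\<le>n. \<bar>u a i\<bar> \<le> D"
proof -
  have "\<exists>D. \<forall>a\<in>A. \<bar>u a i\<bar> \<le> D" if "i \<le> n" for i
    using compact_imp_bounded[OF compact_continuous_image[OF cont[OF that] compact]]
    by (auto simp: bounded_iff)
  then obtain D where D: "\<And>i a. i \<le> n \<Longrightarrow> a \<in> A \<Longrightarrow> \<bar>u a i\<bar> \<le> D i" by metis
  have "\<bar>u a i\<bar> \<le> Max (D ` {..n})" if "a \<in> A" "i \<le> n" for a i
    by (rule order_trans[OF D[OF that(2,1)]]) (use that in \<open>auto intro: Max_ge\<close>)
  then show ?thesis by blast
qed

lemma bounded_exp_util: "\<exists>D. \<forall>a\<in>A. \<forall>p\<in>belief_simplex n. \<bar>exp_util n u a p\<bar> \<le> D"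
proof -
  obtain D where D: "\<And>a i. a \<in> A \<Longrightarrow> i \<le> n \<Longrightarrow> \<bar>u a i\<bar> \<le> D" using bounded_util by blast
  have "\<bar>exp_util n u a p\<bar> \<le> D" if a: "a \<in> A" and p: "p \<in> belief_simplex n" for a p
  proof -
    have "exp_util n u a p \<le> exp_util n (\<lambda>_ _. D) a p + 0"
      by (rule exp_util_le[OF p]) (use D[OF a] in \<open>auto simp: abs_le_iff\<close>)
    moreover have "exp_util n (\<lambda>_ _. - D) a p \<le> exp_util n u a p + 0"
      by (rule exp_util_le[OF p]) (use D[OF a] in \<open>auto simp: abs_le_iff minus_le_iff\<close>)
    ultimately show ?thesis by (simp add: exp_util_const)
  qed
  then show ?thesis by blast
qed

lemma exp_util_le_value: "a \<in> A \<Longrightarrow> p \<in> belief_simplex n \<Longrightarrow> exp_util n u a p \<le> value_fn n A u p"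
proof -
  assume a: "a \<in> A" and p: "p \<in> belief_simplex n"
  obtain D where "\<And>a. a \<in> A \<Longrightarrow> \<bar>exp_util n u a p\<bar> \<le> D" using bounded_exp_util p by blast
  then have "bdd_above ((\<lambda>a. exp_util n u a p) ` A)"
    by (intro bdd_aboveI2[of _ _ D]) (simp add: abs_le_iff)
  then show ?thesis unfolding value_fn_def by (rule cSUP_upper[OF a])
qed

lemma value_leI: "(\<And>a. a \<in> A \<Longrightarrow> exp_util n u a p \<le> y) \<Longrightarrow> value_fn n A u p \<le> y"
  unfolding value_fn_def by (rule cSUP_least[OF nonempty])

lemma bounded_value: "\<exists>D. \<forall>p\<in>belief_simplex n. \<bar>value_fn n A u p\<bar> \<le> D"
proof -
  obtain D where D: "\<And>a p. a \<in> A \<Longrightarrow> p \<in> belief_simplex n \<Longrightarrow> \<bar>exp_util n u a p\<bar> \<le> D"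
    using bounded_exp_util by blast
  obtain a where a: "a \<in> A" using nonempty by blast
  have "\<bar>value_fn n A u p\<bar> \<le> D" if p: "p \<in> belief_simplex n" for p
    using exp_util_le_value[OF a p] D[OF a p] value_leI[of p D] D[OF _ p] by (auto simp: abs_le_iff)
  then show ?thesis by blast
qed

lemma finite_subproblem: "finite B \<Longrightarrow> B \<noteq> {} \<Longrightarrow> B \<subseteq> A \<Longrightarrow> continuous_problem n B u"
  using cont by unfold_locales (auto intro: finite_imp_compact continuous_on_subset)

lemma value_subproblem_le:
  assumes B: "finite B" "B \<noteq> {}" "B \<subseteq> A" and p: "p \<in> belief_simplex n"
  shows "value_fn n B u p \<le> value_fn n A u p"
  using continuous_problem.value_leI[OF finite_subproblem[OF B]] exp_util_le_value[OF _ p] B(3) by blast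

text \<open>The error is uniform in \<open>p\<close> because expected utility averages the state
  utilities, each of which the grid matches up to \<open>e\<close>.\<close>

lemma finite_approximation:
  assumes "0 < e"
  shows "\<exists>B. finite B \<and> B \<noteq> {} \<and> B \<subseteq> A \<and>
    (\<forall>p\<in>belief_simplex n. value_fn n A u p \<le> value_fn n B u p + e)"
proof -
  obtain B where B: "finite B" "B \<noteq> {}" "B \<subseteq> A"
    and near: "\<forall>a\<in>A. \<exists>b\<in>B. \<forall>i\<le>n. \<bar>u a i - u b i\<bar> \<le> e"
    by (rule compact_finite_grid[OF compact nonempty cont assms])
  interpret B: continuous_problem n B u by (rule finite_subproblem[OF B])
  have "value_fn n A u p \<le> value_fn n B u p + e" if p: "p \<in> belief_simplex n" for p
  proof (rule value_leI)
    fix a assume "a \<in> A"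
    then obtain b where b: "b \<in> B" "\<forall>i\<le>n. \<bar>u a i - u b i\<bar> \<le> e" using near by blast
    have "u a i \<le> u b i + e" if "i \<le> n" for i using b(2) that by (auto simp: abs_le_iff algebra_simps)
    from exp_util_le[OF p, of u a u b e, OF this]
    show "exp_util n u a p \<le> value_fn n B u p + e"
      using B.exp_util_le_value[OF b(1) p] by linarith
  qed
  with B show ?thesis by blast
qed

end

lemma decision_problem_continuous:
  assumes "decision_problem n A u"
  shows "continuous_problem n A u"
proof (cases "finite A")
  case True
  with assms show ?thesis
    by unfold_locales (simp_all add: decision_problem_def finite_imp_compact continuous_on_finite)
next
  case False
  with assms obtain c d where "c \<le> d" "A = {c..d}" "\<forall>i\<le>n. (\<lambda>a. u a i) differentiable_on A"
    unfolding decision_problem_def by blast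
  then show ?thesis
    by unfold_locales (simp_all add: differentiable_imp_continuous_on)
qed

text \<open>An experiment relative to an arbitrary reference measure; the intended \<open>M\<close>
  is Lebesgue measure restricted to the signal interval.\<close>

locale signal_structure =
  fixes n :: nat and M :: "real measure" and f :: "nat \<Rightarrow> real \<Rightarrow> real"
  assumes dens_integrable: "\<And>i. i \<le> n \<Longrightarrow> integrable M (f i)"
    and dens_nonneg: "\<And>i x. i \<le> n \<Longrightarrow> x \<in> space M \<Longrightarrow> 0 \<le> f i x"
    and dens_integral: "\<And>i. i \<le> n \<Longrightarrow> (\<integral>x. f i x \<partial>M) = 1"

subsection \<open>Expectations over posteriors\<close>

lemma abs_mult_le_abs_mult: "\<bar>a\<bar> \<le> D \<Longrightarrow> \<bar>a * b\<bar> \<le> \<bar>D * b\<bar>" for a b D :: real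
  by (auto simp: abs_mult intro!: mult_right_mono)

context signal_structure
begin

definition bayes_expect :: "(nat \<Rightarrow> real) \<Rightarrow> ((nat \<Rightarrow> real) \<Rightarrow> real) \<Rightarrow> real" where
  "bayes_expect q h = (\<integral>x. h (posterior n f q x) * mix_density n f q x \<partial>M)"

lemma mix_density_eq: "mix_density n f q x = (\<Sum>i\<le>n. full_belief n q i * f i x)"
  by (simp add: mix_density_def atLeast0AtMost)

lemma dens_measurable: "i \<le> n \<Longrightarrow> f i \<in> borel_measurable M"
  using dens_integrable by auto

lemma mix_density_integrable: "integrable M (mix_density n f q)"
  unfolding mix_density_eq[abs_def] by (intro Bochner_Integration.integrable_sum integrable_mult_right dens_integrable) auto

lemma mix_density_integral: "(\<integral>x. mix_density n f q x \<partial>M) = 1"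
proof -
  have "(\<integral>x. mix_density n f q x \<partial>M) = (\<Sum>i\<le>n. full_belief n q i * (\<integral>x. f i x \<partial>M))"
    unfolding mix_density_eq[abs_def] using dens_integrable by (simp add: Bochner_Integration.integral_sum)
  then show ?thesis by (simp add: dens_integral full_belief_sum)
qed

lemma weighted_dens_nonneg:
  "q \<in> belief_simplex n \<Longrightarrow> x \<in> space M \<Longrightarrow> i \<le> n \<Longrightarrow> 0 \<le> full_belief n q i * f i x"
  by (simp add: full_belief_nonneg dens_nonneg)

lemma mix_density_nonneg: "q \<in> belief_simplex n \<Longrightarrow> x \<in> space M \<Longrightarrow> 0 \<le> mix_density n f q x"
  unfolding mix_density_eq by (intro sum_nonneg) (simp add: weighted_dens_nonneg)

text \<open>Where the mixture density vanishes the posterior is the junk value 0, i.e. the belief that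
  puts all mass on state 0; both sides are then 0.\<close>

lemma full_belief_posterior:
  assumes q: "q \<in> belief_simplex n" and x: "x \<in> space M" and i: "i \<le> n"
  shows "full_belief n (posterior n f q x) i * mix_density n f q x = full_belief n q i * f i x"
proof (cases "mix_density n f q x = 0")
  case True
  then have "full_belief n q i * f i x = 0"
    using sum_nonneg_eq_0_iff[of "{..n}" "\<lambda>i. full_belief n q i * f i x"] weighted_dens_nonneg[OF q x] i
    by (simp add: mix_density_eq)
  with True show ?thesis by simp
next
  case False
  have "mix_density n f q x = full_belief n q 0 * f 0 x + (\<Sum>i=1..n. full_belief n q i * f i x)"
    by (simp add: mix_density_def sum.atLeast_Suc_atMost)
  moreover have "(\<Sum>i=1..n. posterior n f q x i) * mix_density n f q x = (\<Sum>i=1..n. full_belief n q i * f i x)"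
    using False by (simp add: posterior_def sum_distrib_right)
  ultimately have "full_belief n (posterior n f q x) 0 * mix_density n f q x = full_belief n q 0 * f 0 x"
    by (simp add: full_belief_def[of n "posterior n f q x"] left_diff_distrib)
  then show ?thesis
    using False by (cases "i = 0") (simp_all add: full_belief_def[of n "posterior n f q x"] posterior_def)
qed

lemma posterior_simplex:
  assumes q: "q \<in> belief_simplex n" and x: "x \<in> space M"
  shows "posterior n f q x \<in> belief_simplex n"
proof -
  have nonneg: "0 \<le> posterior n f q x i" if "i \<le> n" for i
    unfolding posterior_def using weighted_dens_nonneg[OF q x that] mix_density_nonneg[OF q x] by simp
  have le1: "(\<Sum>i=1..n. posterior n f q x i) \<le> 1"
  proof (cases "mix_density n f q x = 0")
    case False
    then have pos: "0 < mix_density n f q x" using mix_density_nonneg[OF q x] by simp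
    have "(\<Sum>i=1..n. posterior n f q x i) = (\<Sum>i=1..n. full_belief n q i * f i x) / mix_density n f q x"
      by (simp add: posterior_def sum_divide_distrib)
    moreover have "(\<Sum>i=1..n. full_belief n q i * f i x) \<le> mix_density n f q x"
      unfolding mix_density_def by (rule sum_mono2) (use weighted_dens_nonneg[OF q x] in auto)
    ultimately show ?thesis using pos by simp
  qed (simp add: posterior_def)
  have "posterior n f q x i \<le> 1" if "i \<in> {1..n}" for i
  proof -
    have "posterior n f q x i \<le> (\<Sum>i=1..n. posterior n f q x i)"
      by (rule member_le_sum) (use that nonneg in auto)
    with le1 show ?thesis by simp
  qed
  with nonneg le1 show ?thesis by (auto simp: belief_simplex_def)
qed

lemma posterior_measurable: "i \<le> n \<Longrightarrow> (\<lambda>x. posterior n f q x i) \<in> borel_measurable M"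
  unfolding posterior_def mix_density_eq
  by (intro borel_measurable_divide borel_measurable_times borel_measurable_sum borel_measurable_const dens_measurable) auto

lemma linear_posterior_measurable: "(\<lambda>x. \<Sum>i=1..n. b i * posterior n f q x i) \<in> borel_measurable M"
  by (intro borel_measurable_times borel_measurable_sum borel_measurable_const posterior_measurable) auto

lemma exp_util_measurable: "(\<lambda>x. exp_util n u a (posterior n f q x)) \<in> borel_measurable M"
  unfolding exp_util_affine by (intro borel_measurable_add borel_measurable_const linear_posterior_measurable)

text \<open>Clearing the denominator in Bayes' rule links expected utility at the posterior to the
  payoffs in the separate states, weighted by the prior.\<close>

lemma exp_util_mix_density:
  assumes "q \<in> belief_simplex n" "x \<in> space M"
  shows "exp_util n u a (posterior n f q x) * mix_density n f q x = (\<Sum>i\<le>n. full_belief n q i * (u a i * f i x))"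
  unfolding exp_util_def atLeast0AtMost sum_distrib_right
  by (rule sum.cong) (use full_belief_posterior[OF assms] in \<open>auto simp: ac_simps\<close>)

lemma bayes_integrable:
  assumes q: "q \<in> belief_simplex n" and h: "(\<lambda>x. h (posterior n f q x)) \<in> borel_measurable M"
    and D: "\<And>p. p \<in> belief_simplex n \<Longrightarrow> \<bar>h p\<bar> \<le> D"
  shows "integrable M (\<lambda>x. h (posterior n f q x) * mix_density n f q x)"
proof (rule Bochner_Integration.integrable_bound[of _ "\<lambda>x. D * mix_density n f q x"])
  show "AE x in M. norm (h (posterior n f q x) * mix_density n f q x) \<le> norm (D * mix_density n f q x)"
    using D[OF posterior_simplex[OF q]]
    by (intro AE_I2) (auto intro: abs_mult_le_abs_mult)
qed (use h mix_density_integrable[of q] in auto)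

text \<open>The mixture density integrates to 1, so a uniform error \<open>e\<close> in the
  integrand contributes exactly \<open>e\<close>.\<close>

lemma bayes_expect_mono:
  assumes q: "q \<in> belief_simplex n"
    and h1: "integrable M (\<lambda>x. h1 (posterior n f q x) * mix_density n f q x)"
    and h2: "integrable M (\<lambda>x. h2 (posterior n f q x) * mix_density n f q x)"
    and le: "\<And>p. p \<in> belief_simplex n \<Longrightarrow> h1 p \<le> h2 p + e"
  shows "bayes_expect q h1 \<le> bayes_expect q h2 + e"
proof -
  have "bayes_expect q h1 \<le> (\<integral>x. h2 (posterior n f q x) * mix_density n f q x + e * mix_density n f q x \<partial>M)"
    unfolding bayes_expect_def
  proof (rule integral_mono[OF h1])
    fix x assume x: "x \<in> space M"
    show "h1 (posterior n f q x) * mix_density n f q x \<le> h2 (posterior n f q x) * mix_density n f q x + e * mix_density n f q x"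
      using mult_right_mono[OF le[OF posterior_simplex[OF q x]] mix_density_nonneg[OF q x]]
      by (simp add: distrib_right)
  qed (use h2 mix_density_integrable[of q] in auto)
  also have "\<dots> = bayes_expect q h2 + e"
    unfolding bayes_expect_def using h2 mix_density_integrable[of q] by (simp add: mix_density_integral)
  finally show ?thesis .
qed

text \<open>On beliefs the linear form stays within the sum of the \<open>\<bar>b i\<bar>\<close>,
  and on that compact interval the continuous function \<open>C\<close> is bounded.\<close>

lemma convex_posterior_integrable:
  assumes q: "q \<in> belief_simplex n" and C: "convex_on UNIV C"
  shows "integrable M (\<lambda>x. C (\<Sum>i=1..n. b i * posterior n f q x i) * mix_density n f q x)"
proof -
  have cont: "continuous_on UNIV C" by (rule convex_on_continuous[OF open_UNIV C])
  define R where "R = (\<Sum>i=1..n. \<bar>b i\<bar>)"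
  have "bounded (C ` {-R..R})"
    by (intro compact_imp_bounded compact_continuous_image continuous_on_subset[OF cont]) auto
  then obtain D where D: "\<And>t. t \<in> {-R..R} \<Longrightarrow> \<bar>C t\<bar> \<le> D"
    unfolding bounded_iff real_norm_def by blast
  show ?thesis
  proof (rule bayes_integrable[OF q, of "\<lambda>p. C (\<Sum>i=1..n. b i * p i)" D])
    show "(\<lambda>x. C (\<Sum>i=1..n. b i * posterior n f q x i)) \<in> borel_measurable M"
      by (rule measurable_compose[OF linear_posterior_measurable borel_measurable_continuous_onI[OF cont]])
  next
    fix p assume p: "p \<in> belief_simplex n"
    have "\<bar>\<Sum>i=1..n. b i * p i\<bar> \<le> (\<Sum>i=1..n. \<bar>b i * p i\<bar>)" by (rule sum_abs)
    also have "\<dots> \<le> R" unfolding R_def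
    proof (rule sum_mono)
      fix i assume "i \<in> {1..n}"
      then have "\<bar>p i\<bar> \<le> 1" using p by (auto simp: belief_simplex_def)
      then show "\<bar>b i * p i\<bar> \<le> \<bar>b i\<bar>" by (simp add: abs_mult mult_left_le)
    qed
    finally show "\<bar>C (\<Sum>i=1..n. b i * p i)\<bar> \<le> D" by (intro D) auto
  qed
qed

text \<open>A supremum over an uncountable action set is not visibly measurable. It is obtained as a
  pointwise limit of values of finite subproblems, which are finite suprema of measurable
  functions.\<close>

lemma value_measurable:
  assumes P: "continuous_problem n A u" and q: "q \<in> belief_simplex n"
  shows "(\<lambda>x. value_fn n A u (posterior n f q x)) \<in> borel_measurable M"
proof -
  interpret continuous_problem n A u by (rule P)
  have fin: "(\<lambda>x. value_fn n B u (posterior n f q x)) \<in> borel_measurable M"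
    if "finite B" "B \<noteq> {}" for B
    unfolding value_fn_def using that
    by (intro borel_measurable_cSUP exp_util_measurable) (auto intro: countable_finite)
  define e where "e k = 1 / real (Suc k)" for k
  have "\<exists>B. finite B \<and> B \<noteq> {} \<and> B \<subseteq> A \<and> (\<forall>p\<in>belief_simplex n. value_fn n A u p \<le> value_fn n B u p + e k)" for k
    by (rule finite_approximation) (simp add: e_def)
  then obtain B where B: "\<And>k. finite (B k)" "\<And>k. B k \<noteq> {}" "\<And>k. B k \<subseteq> A"
    "\<And>k p. p \<in> belief_simplex n \<Longrightarrow> value_fn n A u p \<le> value_fn n (B k) u p + e k"
    by metis
  show ?thesis
  proof (rule borel_measurable_LIMSEQ_real)
    show "(\<lambda>x. value_fn n (B k) u (posterior n f q x)) \<in> borel_measurable M" for k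
      by (rule fin[OF B(1,2)])
    fix x assume "x \<in> space M"
    then have p: "posterior n f q x \<in> belief_simplex n" by (rule posterior_simplex[OF q])
    show "(\<lambda>k. value_fn n (B k) u (posterior n f q x)) \<longlonglongrightarrow> value_fn n A u (posterior n f q x)"
    proof (rule tendsto_sandwich)
      show "(\<lambda>k. value_fn n A u (posterior n f q x) - e k) \<longlonglongrightarrow> value_fn n A u (posterior n f q x)"
        using tendsto_diff[OF tendsto_const LIMSEQ_inverse_real_of_nat] by (simp add: e_def inverse_eq_divide)
      show "\<forall>\<^sub>F k in sequentially. value_fn n A u (posterior n f q x) - e k \<le> value_fn n (B k) u (posterior n f q x)"
        using B(4)[OF p] by (auto intro!: always_eventually simp: diff_le_eq)
      show "\<forall>\<^sub>F k in sequentially. value_fn n (B k) u (posterior n f q x) \<le> value_fn n A u (posterior n f q x)"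
        using value_subproblem_le[OF B(1-3) p] by (intro always_eventually allI)
    qed simp
  qed
qed

lemma value_integrable:
  assumes P: "continuous_problem n A u" and q: "q \<in> belief_simplex n"
  shows "integrable M (\<lambda>x. value_fn n A u (posterior n f q x) * mix_density n f q x)"
  using continuous_problem.bounded_value[OF P] bayes_integrable[OF q value_measurable[OF P q]] by blast

text \<open>Maximising at each signal over a finite grid keeps the choice measurable and costs at
  most \<open>e\<close>. The resulting pure strategy has its payoff written state by state, the form
  in which strategies are compared.\<close>

lemma near_optimal_selection:
  assumes P: "continuous_problem n A u" and q: "q \<in> belief_simplex n" and e: "0 < e"
  shows "\<exists>s\<in>borel_measurable M. (\<forall>x. s x \<in> A) \<and> (\<forall>i\<le>n. (\<lambda>x. u (s x) i) \<in> borel_measurable M) \<and>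
    bayes_expect q (value_fn n A u) - e \<le> (\<Sum>i\<le>n. full_belief n q i * (\<integral>x. u (s x) i * f i x \<partial>M))"
proof -
  interpret continuous_problem n A u by (rule P)
  obtain B where B: "finite B" "B \<noteq> {}" "B \<subseteq> A"
    and app: "\<And>p. p \<in> belief_simplex n \<Longrightarrow> value_fn n A u p \<le> value_fn n B u p + e"
    using finite_approximation[OF e] by blast
  interpret B: continuous_problem n B u by (rule finite_subproblem[OF B])
  obtain s where s: "\<And>x. s x \<in> B"
    "\<And>b x. b \<in> B \<Longrightarrow> exp_util n u b (posterior n f q x) \<le> exp_util n u (s x) (posterior n f q x)"
    "\<And>h :: real \<Rightarrow> real \<Rightarrow> real. \<forall>b\<in>B. h b \<in> borel_measurable M \<Longrightarrow> (\<lambda>x. h (s x) x) \<in> borel_measurable M"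
    using measurable_argmax[OF B(1,2), of "\<lambda>b x. exp_util n u b (posterior n f q x)" M, OF ballI, OF exp_util_measurable]
    by (elim exE conjE) blast
  have sA: "s x \<in> A" for x using s(1) B(3) by blast
  \<comment> \<open>Families that are constant in the signal, first \<open>b\<close> itself and then
    \<open>u b i\<close>, extract the concrete measurability statements.\<close>
  have sm: "s \<in> borel_measurable M" using s(3)[of "\<lambda>b x. b"] by simp
  have um: "(\<lambda>x. u (s x) i) \<in> borel_measurable M" for i using s(3)[of "\<lambda>b x. u b i"] by simp
  obtain D where D: "\<And>a i. a \<in> A \<Longrightarrow> i \<le> n \<Longrightarrow> \<bar>u a i\<bar> \<le> D" using bounded_util by blast
  have ui: "integrable M (\<lambda>x. u (s x) i * f i x)" if i: "i \<le> n" for i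
  proof (rule Bochner_Integration.integrable_bound[of _ "\<lambda>x. D * f i x"])
    show "AE x in M. norm (u (s x) i * f i x) \<le> norm (D * f i x)"
      using D[OF sA i] by (intro AE_I2) (auto intro: abs_mult_le_abs_mult)
  qed (use dens_integrable[OF i] um in auto)
  have "bayes_expect q (value_fn n A u) - e
      = (\<integral>x. value_fn n A u (posterior n f q x) * mix_density n f q x - e * mix_density n f q x \<partial>M)"
    unfolding bayes_expect_def using value_integrable[OF P q] mix_density_integrable
    by (simp add: mix_density_integral)
  also have "\<dots> \<le> (\<integral>x. (\<Sum>i\<le>n. full_belief n q i * (u (s x) i * f i x)) \<partial>M)"
  proof (rule integral_mono)
    fix x assume x: "x \<in> space M"
    note p = posterior_simplex[OF q x]
    have "value_fn n B u (posterior n f q x) \<le> exp_util n u (s x) (posterior n f q x)"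
      by (rule B.value_leI) (rule s(2))
    then have "value_fn n A u (posterior n f q x) - e \<le> exp_util n u (s x) (posterior n f q x)"
      using app[OF p] by linarith
    from mult_right_mono[OF this mix_density_nonneg[OF q x]]
    show "value_fn n A u (posterior n f q x) * mix_density n f q x - e * mix_density n f q x
        \<le> (\<Sum>i\<le>n. full_belief n q i * (u (s x) i * f i x))"
      by (simp add: exp_util_mix_density[OF q x] left_diff_distrib)
  qed (use ui value_integrable[OF P q] mix_density_integrable[of q] in auto)
  also have "\<dots> = (\<Sum>i\<le>n. full_belief n q i * (\<integral>x. u (s x) i * f i x \<partial>M))"
    using ui by simp
  finally show ?thesis using sm sA um by blast
qed

text \<open>At each signal a randomised action earns at most the optimal expected utility under the
  posterior; integrating over signals gives the bound. The preliminary facts only secure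
  integrability.\<close>

lemma strategy_value_le:
  assumes P: "continuous_problem n A u" and q: "q \<in> belief_simplex n"
    and \<sigma>: "\<sigma> \<in> M \<rightarrow>\<^sub>M prob_algebra (restrict_space borel A)"
  shows "(\<Sum>i\<le>n. full_belief n q i * (\<integral>x. (\<integral>t. u t i \<partial>\<sigma> x) * f i x \<partial>M)) \<le> bayes_expect q (value_fn n A u)"
proof -
  interpret continuous_problem n A u by (rule P)
  obtain D where D: "\<And>a i. a \<in> A \<Longrightarrow> i \<le> n \<Longrightarrow> \<bar>u a i\<bar> \<le> D" using bounded_util by blast
  have um: "(\<lambda>t. u t i) \<in> borel_measurable (restrict_space borel A)" if "i \<le> n" for i
    by (rule borel_measurable_continuous_on_restrict[OF cont[OF that]])
  have \<sigma>x: "prob_space (\<sigma> x)" "sets (\<sigma> x) = sets (restrict_space borel A)" "space (\<sigma> x) = A"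
    if "x \<in> space M" for x
  proof -
    show "prob_space (\<sigma> x)" "sets (\<sigma> x) = sets (restrict_space borel A)"
      using measurable_space[OF \<sigma> that] by (auto simp: space_prob_algebra)
    from sets_eq_imp_space_eq[OF this(2)] show "space (\<sigma> x) = A" by (simp add: space_restrict_space)
  qed
  have u_int: "integrable (\<sigma> x) (\<lambda>t. u t i)" if x: "x \<in> space M" and i: "i \<le> n" for x i
  proof -
    interpret prob_space "\<sigma> x" by (rule \<sigma>x(1)[OF x])
    show ?thesis
      by (rule integrable_const_bound[of _ D])
        (use D[OF _ i] \<sigma>x(3)[OF x] um[OF i] measurable_cong_sets[OF \<sigma>x(2)[OF x] refl] in auto)
  qed
  have Um: "(\<lambda>x. \<integral>t. u t i \<partial>\<sigma> x) \<in> borel_measurable M" if "i \<le> n" for i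
    by (rule measurable_compose[OF measurable_prob_algebraD[OF \<sigma>] integral_measurable_subprob_algebra[OF um[OF that]]])
  have U_bound: "\<bar>\<integral>t. u t i \<partial>\<sigma> x\<bar> \<le> D" if x: "x \<in> space M" and i: "i \<le> n" for x i
  proof -
    interpret prob_space "\<sigma> x" by (rule \<sigma>x(1)[OF x])
    have "\<bar>\<integral>t. u t i \<partial>\<sigma> x\<bar> \<le> (\<integral>t. \<bar>u t i\<bar> \<partial>\<sigma> x)" by (rule integral_abs_bound)
    also have "\<dots> \<le> (\<integral>t. D \<partial>\<sigma> x)"
      by (rule integral_mono) (use u_int[OF x i] D[OF _ i] \<sigma>x(3)[OF x] in auto)
    finally show ?thesis by (simp add: prob_space)
  qed
  have Ui: "integrable M (\<lambda>x. (\<integral>t. u t i \<partial>\<sigma> x) * f i x)" if i: "i \<le> n" for i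
  proof (rule Bochner_Integration.integrable_bound[of _ "\<lambda>x. D * f i x"])
    show "AE x in M. norm ((\<integral>t. u t i \<partial>\<sigma> x) * f i x) \<le> norm (D * f i x)"
      using U_bound[OF _ i] by (intro AE_I2) (auto intro: abs_mult_le_abs_mult)
  qed (use dens_integrable[OF i] Um[OF i] in auto)
  have "(\<Sum>i\<le>n. full_belief n q i * (\<integral>x. (\<integral>t. u t i \<partial>\<sigma> x) * f i x \<partial>M))
      = (\<integral>x. (\<Sum>i\<le>n. full_belief n q i * ((\<integral>t. u t i \<partial>\<sigma> x) * f i x)) \<partial>M)"
    using Ui by simp
  also have "\<dots> \<le> bayes_expect q (value_fn n A u)"
    unfolding bayes_expect_def
  proof (rule integral_mono[OF _ value_integrable[OF P q]])
    fix x assume x: "x \<in> space M"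
    interpret S: prob_space "\<sigma> x" by (rule \<sigma>x(1)[OF x])
    note p = posterior_simplex[OF q x]
    have "(\<Sum>i\<le>n. full_belief n q i * ((\<integral>t. u t i \<partial>\<sigma> x) * f i x))
        = (\<Sum>i\<le>n. full_belief n (posterior n f q x) i * (\<integral>t. u t i \<partial>\<sigma> x)) * mix_density n f q x"
      unfolding sum_distrib_right
      by (rule sum.cong) (use full_belief_posterior[OF q x] in \<open>auto simp: ac_simps\<close>)
    also have "(\<Sum>i\<le>n. full_belief n (posterior n f q x) i * (\<integral>t. u t i \<partial>\<sigma> x))
        = (\<integral>t. exp_util n u t (posterior n f q x) \<partial>\<sigma> x)"
      unfolding exp_util_def atLeast0AtMost using u_int[OF x] by simp
    also have "\<dots> \<le> (\<integral>t. value_fn n A u (posterior n f q x) \<partial>\<sigma> x)"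
    proof (rule integral_mono)
      show "integrable (\<sigma> x) (\<lambda>t. exp_util n u t (posterior n f q x))"
        unfolding exp_util_def atLeast0AtMost
        by (intro Bochner_Integration.integrable_sum integrable_mult_right) (use u_int[OF x] in auto)
    qed (use exp_util_le_value[OF _ p] \<sigma>x(3)[OF x] in auto)
    finally show "(\<Sum>i\<le>n. full_belief n q i * ((\<integral>t. u t i \<partial>\<sigma> x) * f i x))
        \<le> value_fn n A u (posterior n f q x) * mix_density n f q x"
      using mix_density_nonneg[OF q x] by (simp add: S.prob_space mult_right_mono)
  qed (use Ui in auto)
  finally show ?thesis .
qed

end

subsection \<open>Linear-convex dominance and values\<close>

lemma convex_on_pos_part: "convex_on UNIV (\<lambda>t :: real. max 0 (c + t))"
proof (rule convex_onI)
  fix t x y :: real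
  assume t: "0 < t" "t < 1"
  have "(1 - t) * (c + x) \<le> (1 - t) * max 0 (c + x)" "t * (c + y) \<le> t * max 0 (c + y)"
    using t by (simp_all add: mult_left_mono)
  moreover have "0 \<le> (1 - t) * max 0 (c + x)" "0 \<le> t * max 0 (c + y)" using t by simp_all
  moreover have "c + ((1 - t) * x + t * y) = (1 - t) * (c + x) + t * (c + y)"
    by (simp add: algebra_simps)
  ultimately show "max 0 (c + ((1 - t) *\<^sub>R x + t *\<^sub>R y)) \<le> (1 - t) * max 0 (c + x) + t * max 0 (c + y)"
    by simp
qed simp

lemma value_fn_finite: "finite B \<Longrightarrow> B \<noteq> {} \<Longrightarrow> value_fn n B u p = Max ((\<lambda>a. exp_util n u a p) ` B)"
  unfolding value_fn_def by (rule cSup_eq_Max) auto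

text \<open>If the new largest action beats the previously largest one, quasi-concavity makes the latter
  optimal among the old actions.\<close>

lemma value_fn_insert_greatest:
  assumes B: "finite B" "B \<noteq> {}" and m: "\<forall>b\<in>B. b < m"
    and qc: "quasiconcave_on (insert m B) (\<lambda>a. exp_util n u a p)"
  shows "value_fn n (insert m B) u p
    = value_fn n B u p + max 0 (exp_util n u m p - exp_util n u (Max B) p)"
proof -
  let ?h = "\<lambda>a. exp_util n u a p"
  have MB: "Max B \<in> B" using B by (rule Max_in)
  have ins: "value_fn n (insert m B) u p = max (?h m) (value_fn n B u p)"
    using B by (simp add: value_fn_finite)
  have le: "?h (Max B) \<le> value_fn n B u p"
    using B MB by (simp add: value_fn_finite)
  show ?thesis
  proof (cases "?h m \<le> ?h (Max B)")
    case True
    then show ?thesis using ins le by simp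
  next
    case False
    have "?h b \<le> ?h (Max B)" if "b \<in> B" for b
      using quasiconcave_onD[OF qc, of b m "Max B"] that MB m B(1) False by (auto simp: min_def split: if_splits)
    then have "value_fn n B u p \<le> ?h (Max B)"
      using B by (simp add: value_fn_finite)
    with le ins False show ?thesis by simp
  qed
qed

lemma exp_util_diff:
  "exp_util n u a p - exp_util n u b p
    = (u a 0 - u b 0) + (\<Sum>i=1..n. ((u a i - u a 0) - (u b i - u b 0)) * p i)"
  by (simp add: exp_util_affine left_diff_distrib sum_subtractf)

locale experiment_pair =
  F: signal_structure n M f + G: signal_structure n N g
  for n M f N g
begin

text \<open>Actions are added in increasing order. By \<open>value_fn_insert_greatest\<close> each
  addition raises the value by the positive part of an affine form in the belief, for which
  \<open>dom\<close> gives the comparison.\<close>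

lemma finite_QCC_value_le:
  assumes q: "q \<in> belief_simplex n"
    and dom: "\<And>b C. convex_on UNIV C \<Longrightarrow>
      G.bayes_expect q (\<lambda>p. C (\<Sum>i=1..n. b i * p i)) \<le> F.bayes_expect q (\<lambda>p. C (\<Sum>i=1..n. b i * p i))"
    and B: "finite B" "B \<noteq> {}" "QCC n B u"
  shows "G.bayes_expect q (value_fn n B u) \<le> F.bayes_expect q (value_fn n B u)"
  using B
proof (induction B rule: finite_linorder_max_induct)
  case (insert m B)
  show ?case
  proof (cases "B = {}")
    \<comment> \<open>The true base case, as the empty action set is excluded: with a single action
      the value is affine, and \<open>dom\<close> applies to an affine \<open>C\<close>.\<close>
    case True
    have "value_fn n {m} u = (\<lambda>p. u m 0 + (\<Sum>i=1..n. (u m i - u m 0) * p i))"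
      by (simp add: fun_eq_iff value_fn_finite exp_util_affine)
    moreover have "convex_on UNIV (\<lambda>t :: real. u m 0 + t)"
      by (intro convex_onI) (auto simp: algebra_simps)
    ultimately show ?thesis using dom True by simp
  next
    case False
    let ?d = "\<lambda>p. max 0 ((u m 0 - u (Max B) 0) + (\<Sum>i=1..n. ((u m i - u m 0) - (u (Max B) i - u (Max B) 0)) * p i))"
    have qc: "quasiconcave_on (insert m B) (\<lambda>a. exp_util n u a p)" if "p \<in> belief_simplex n" for p
      using insert.prems(2) that by (simp add: QCC_def)
    have "QCC n B u"
      using qc unfolding QCC_def quasiconcave_on_def by blast
    then have IH: "G.bayes_expect q (value_fn n B u) \<le> F.bayes_expect q (value_fn n B u)"
      using insert.IH False by blast
    have P: "continuous_problem n B u"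
      using insert.hyps False by unfold_locales (simp_all add: finite_imp_compact continuous_on_finite)
    have eq: "value_fn n (insert m B) u p = value_fn n B u p + ?d p" if "p \<in> belief_simplex n" for p
      using value_fn_insert_greatest[OF insert.hyps(1) False insert.hyps(2) qc[OF that]]
      by (simp add: exp_util_diff)
    have split: "signal_structure.bayes_expect n K h q (value_fn n (insert m B) u)
      = signal_structure.bayes_expect n K h q (value_fn n B u) + signal_structure.bayes_expect n K h q ?d"
      if S: "signal_structure n K h" for K h
    proof -
      interpret S: signal_structure n K h by (rule S)
      have "S.bayes_expect q (value_fn n (insert m B) u)
          = (\<integral>x. value_fn n B u (posterior n h q x) * mix_density n h q x + ?d (posterior n h q x) * mix_density n h q x \<partial>K)"
        unfolding S.bayes_expect_def
        by (rule Bochner_Integration.integral_cong) (simp_all add: eq[OF S.posterior_simplex[OF q]] distrib_right)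
      also have "\<dots> = S.bayes_expect q (value_fn n B u) + S.bayes_expect q ?d"
        unfolding S.bayes_expect_def
        by (rule Bochner_Integration.integral_add[OF S.value_integrable[OF P q]
              S.convex_posterior_integrable[OF q convex_on_pos_part]])
      finally show ?thesis .
    qed
    show ?thesis
      unfolding split[OF F.signal_structure_axioms] split[OF G.signal_structure_axioms]
      by (rule add_mono[OF IH dom[OF convex_on_pos_part]])
  qed
qed simp

lemma QCC_value_le:
  assumes q: "q \<in> belief_simplex n"
    and dom: "\<And>b C. convex_on UNIV C \<Longrightarrow>
      G.bayes_expect q (\<lambda>p. C (\<Sum>i=1..n. b i * p i)) \<le> F.bayes_expect q (\<lambda>p. C (\<Sum>i=1..n. b i * p i))"
    and P: "continuous_problem n A u" and qcc: "QCC n A u"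
  shows "G.bayes_expect q (value_fn n A u) \<le> F.bayes_expect q (value_fn n A u)"
proof (rule field_le_epsilon)
  fix e :: real assume e: "0 < e"
  interpret continuous_problem n A u by (rule P)
  obtain B where B: "finite B" "B \<noteq> {}" "B \<subseteq> A"
    and app: "\<And>p. p \<in> belief_simplex n \<Longrightarrow> value_fn n A u p \<le> value_fn n B u p + e"
    using finite_approximation[OF e] by blast
  note PB = finite_subproblem[OF B]
  \<comment> \<open>Quasi-concavity on a set only tests combinations lying in that set, so it passes
    to arbitrary subsets.\<close>
  have qB: "QCC n B u"
    using qcc B(3) unfolding QCC_def quasiconcave_on_def by blast
  have "G.bayes_expect q (value_fn n A u) \<le> G.bayes_expect q (value_fn n B u) + e"
    by (rule G.bayes_expect_mono[OF q G.value_integrable[OF P q] G.value_integrable[OF PB q] app])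
  also have "G.bayes_expect q (value_fn n B u) \<le> F.bayes_expect q (value_fn n B u)"
    by (rule finite_QCC_value_le[OF q dom B(1,2) qB])
  also have "F.bayes_expect q (value_fn n B u) \<le> F.bayes_expect q (value_fn n A u) + 0"
    by (rule F.bayes_expect_mono[OF q F.value_integrable[OF PB q] F.value_integrable[OF P q]])
      (use value_subproblem_le[OF B] in simp)
  finally show "G.bayes_expect q (value_fn n A u) \<le> F.bayes_expect q (value_fn n A u) + e"
    by simp
qed

lemma convex_expect_le:
  assumes q: "q \<in> belief_simplex n"
    and val: "\<And>B u. finite B \<Longrightarrow> B \<noteq> {} \<Longrightarrow> QCC n B u \<Longrightarrow>
      G.bayes_expect q (value_fn n B u) \<le> F.bayes_expect q (value_fn n B u)"
    and C: "convex_on UNIV C"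
  shows "G.bayes_expect q (\<lambda>p. C (\<Sum>i=1..n. b i * p i)) \<le> F.bayes_expect q (\<lambda>p. C (\<Sum>i=1..n. b i * p i))"
proof (rule field_le_epsilon)
  fix e :: real assume e: "0 < e"
  obtain s where s: "\<And>x y. C x + s x * (y - x) \<le> C y" using convex_subgradients[OF C] by blast
  define R where "R = (\<Sum>i=1..n. \<bar>b i\<bar>)"
  obtain B where B: "finite B" "B \<noteq> {}"
    and app: "\<And>t. \<bar>t\<bar> \<le> R \<Longrightarrow> \<exists>a\<in>B. C t - e \<le> C a + s a * (t - a)"
    using convex_approx_tangents[OF C s e] by metis
  \<comment> \<open>Action \<open>a\<close> stands for the tangent of \<open>C\<close> at
    \<open>a\<close>, evaluated in state \<open>i\<close> at \<open>b i\<close> and in state 0 at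
    \<open>0\<close>. Averaging over states evaluates this tangent at the linear form in the
    belief.\<close>
  define u where "u a i = C a + s a * ((if i = 0 then 0 else b i) - a)" for a and i :: nat
  have eu: "exp_util n u a p = C a + s a * ((\<Sum>i=1..n. b i * p i) - a)" for a p
  proof -
    have "(\<Sum>i=1..n. (u a i - u a 0) * p i) = (\<Sum>i=1..n. s a * (b i * p i))"
      by (rule sum.cong) (auto simp: u_def algebra_simps)
    then show ?thesis
      unfolding exp_util_affine by (simp add: u_def sum_distrib_left algebra_simps)
  qed
  have s_mono: "s x \<le> s y" if "x < y" for x y
  proof -
    have "(s x - s y) * (y - x) \<le> 0"
      using s[of x y] s[of y x] by (simp add: algebra_simps)
    then show ?thesis using that by (simp add: mult_le_0_iff)
  qed
  have qB: "QCC n B u"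
    unfolding QCC_def eu
  proof (intro ballI quasiconcave_onI)
    fix p :: "nat \<Rightarrow> real" and x y z :: real
    assume xyz: "x \<le> z" "z \<le> y"
    define t where "t = (\<Sum>i=1..n. b i * p i)"
    show "min (C x + s x * ((\<Sum>i=1..n. b i * p i) - x)) (C y + s y * ((\<Sum>i=1..n. b i * p i) - y))
        \<le> C z + s z * ((\<Sum>i=1..n. b i * p i) - z)"
      unfolding t_def[symmetric]
    \<comment> \<open>Seen from the point \<open>t\<close>, tangents get lower as their point of
      contact moves away from \<open>t\<close> on one side: the tangent at \<open>z\<close> beats
      the one at \<open>y\<close> if \<open>t \<le> z\<close>, and the one at \<open>x\<close>
      otherwise.\<close>
    proof (cases "t \<le> z")
      case True
      have "(s y - s z) * (t - z) \<le> 0"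
      proof (cases "z = y")
        case False
        then show ?thesis using s_mono[of z y] xyz True by (simp add: mult_le_0_iff)
      qed simp
      then have "C y + s y * (t - y) \<le> C z + s z * (t - z)"
        using s[of y z] by (simp add: algebra_simps)
      then show "min (C x + s x * (t - x)) (C y + s y * (t - y)) \<le> C z + s z * (t - z)" by simp
    next
      case False
      have "0 \<le> (s z - s x) * (t - z)"
      proof (cases "x = z")
        case neq: False
        then show ?thesis using s_mono[of x z] xyz False by simp
      qed simp
      then have "C x + s x * (t - x) \<le> C z + s z * (t - z)"
        using s[of x z] by (simp add: algebra_simps)
      then show "min (C x + s x * (t - x)) (C y + s y * (t - y)) \<le> C z + s z * (t - z)" by simp
    qed
  qed
  have P: "continuous_problem n B u"
    using B by unfold_locales (simp_all add: finite_imp_compact continuous_on_finite)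
  have low: "value_fn n B u p \<le> C (\<Sum>i=1..n. b i * p i) + 0" for p
    by (simp, rule continuous_problem.value_leI[OF P]) (simp add: eu s)
  have up: "C (\<Sum>i=1..n. b i * p i) \<le> value_fn n B u p + e" if p: "p \<in> belief_simplex n" for p
  proof -
    have "\<bar>\<Sum>i=1..n. b i * p i\<bar> \<le> R"
      unfolding R_def
    proof (rule order_trans[OF sum_abs sum_mono])
      fix i assume "i \<in> {1..n}"
      then have "\<bar>p i\<bar> \<le> 1" using p by (auto simp: belief_simplex_def)
      then show "\<bar>b i * p i\<bar> \<le> \<bar>b i\<bar>" by (simp add: abs_mult mult_left_le)
    qed
    from app[OF this] obtain a where a: "a \<in> B"
      "C (\<Sum>i=1..n. b i * p i) - e \<le> C a + s a * ((\<Sum>i=1..n. b i * p i) - a)"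
      by blast
    with continuous_problem.exp_util_le_value[OF P a(1) p] show ?thesis
      unfolding eu by linarith
  qed
  have "G.bayes_expect q (\<lambda>p. C (\<Sum>i=1..n. b i * p i)) \<le> G.bayes_expect q (value_fn n B u) + e"
    by (rule G.bayes_expect_mono[OF q G.convex_posterior_integrable[OF q C] G.value_integrable[OF P q] up])
  also have "G.bayes_expect q (value_fn n B u) \<le> F.bayes_expect q (value_fn n B u)"
    by (rule val[OF B qB])
  also have "F.bayes_expect q (value_fn n B u) \<le> F.bayes_expect q (\<lambda>p. C (\<Sum>i=1..n. b i * p i)) + 0"
    by (rule F.bayes_expect_mono[OF q F.value_integrable[OF P q] F.convex_posterior_integrable[OF q C] low])
  finally show "G.bayes_expect q (\<lambda>p. C (\<Sum>i=1..n. b i * p i)) \<le> F.bayes_expect q (\<lambda>p. C (\<Sum>i=1..n. b i * p i)) + e"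
    by simp
qed

text \<open>A nearly optimal pure strategy under \<open>G\<close>, written with Dirac measures, is
  matched in every state by a strategy under \<open>F\<close>. Averaging the matched payoffs with
  the prior \<open>q\<close> stays below the value under \<open>F\<close>.\<close>

lemma strategies_value_le:
  assumes q: "q \<in> belief_simplex n" and P: "continuous_problem n A u"
    and strat: "\<And>\<tau>. \<tau> \<in> N \<rightarrow>\<^sub>M prob_algebra (restrict_space borel A) \<Longrightarrow>
      \<exists>\<sigma>\<in>M \<rightarrow>\<^sub>M prob_algebra (restrict_space borel A).
        \<forall>i\<le>n. (\<integral>y. (\<integral>t. u t i \<partial>\<tau> y) * g i y \<partial>N) \<le> (\<integral>x. (\<integral>t. u t i \<partial>\<sigma> x) * f i x \<partial>M)"
  shows "G.bayes_expect q (value_fn n A u) \<le> F.bayes_expect q (value_fn n A u)"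
proof (rule field_le_epsilon)
  fix e :: real assume e: "0 < e"
  interpret continuous_problem n A u by (rule P)
  obtain s where s: "s \<in> borel_measurable N" "\<And>x. s x \<in> A"
    and opt: "G.bayes_expect q (value_fn n A u) - e \<le> (\<Sum>i\<le>n. full_belief n q i * (\<integral>y. u (s y) i * g i y \<partial>N))"
    using G.near_optimal_selection[OF P q e] by blast
  define \<tau> where "\<tau> y = return (restrict_space borel A) (s y)" for y
  have sA: "s \<in> N \<rightarrow>\<^sub>M restrict_space borel A"
    by (rule measurable_restrict_space2) (use s in auto)
  have "\<tau> \<in> N \<rightarrow>\<^sub>M prob_algebra (restrict_space borel A)"
    unfolding \<tau>_def by (rule measurable_compose[OF sA measurable_return_prob_space])
  from strat[OF this] obtain \<sigma> where \<sigma>: "\<sigma> \<in> M \<rightarrow>\<^sub>M prob_algebra (restrict_space borel A)"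
    and le: "\<And>i. i \<le> n \<Longrightarrow> (\<integral>y. (\<integral>t. u t i \<partial>\<tau> y) * g i y \<partial>N) \<le> (\<integral>x. (\<integral>t. u t i \<partial>\<sigma> x) * f i x \<partial>M)"
    by blast
  have \<tau>u: "(\<integral>t. u t i \<partial>\<tau> y) = u (s y) i" if "i \<le> n" for i y
    unfolding \<tau>_def
    by (rule integral_return[OF _ borel_measurable_continuous_on_restrict[OF cont[OF that]]])
      (simp add: space_restrict_space s(2))
  have "(\<Sum>i\<le>n. full_belief n q i * (\<integral>y. u (s y) i * g i y \<partial>N))
      \<le> (\<Sum>i\<le>n. full_belief n q i * (\<integral>x. (\<integral>t. u t i \<partial>\<sigma> x) * f i x \<partial>M))"
    by (intro sum_mono mult_left_mono full_belief_nonneg[OF q]) (use le \<tau>u in auto)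
  with opt F.strategy_value_le[OF P q \<sigma>]
  show "G.bayes_expect q (value_fn n A u) \<le> F.bayes_expect q (value_fn n A u) + e"
    by linarith
qed

end

subsection \<open>Dominating strategies\<close>

text \<open>On the exceptional null set, chosen for all \<open>j\<close> at once, \<open>w\<close>
  copies \<open>v 0\<close>. Pointwise constraints that are closed under limits therefore hold for
  \<open>w\<close> at every point, not merely almost everywhere.\<close>

lemma AE_limit_representative:
  fixes v :: "nat \<Rightarrow> 'j \<Rightarrow> 'a \<Rightarrow> real"
  assumes J: "finite J" and meas: "\<And>k j. j \<in> J \<Longrightarrow> v k j \<in> borel_measurable M"
    and conv: "\<And>j. j \<in> J \<Longrightarrow> AE x in M. convergent (\<lambda>k. v k j x)"
  obtains w where "\<And>j. j \<in> J \<Longrightarrow> w j \<in> borel_measurable M"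
    "\<And>x. x \<in> space M \<Longrightarrow> (\<forall>j\<in>J. w j x = v 0 j x) \<or> (\<forall>j\<in>J. (\<lambda>k. v k j x) \<longlonglongrightarrow> w j x)"
    "\<And>j. j \<in> J \<Longrightarrow> AE x in M. (\<lambda>k. v k j x) \<longlonglongrightarrow> w j x"
proof -
  have "AE x in M. \<forall>j\<in>J. convergent (\<lambda>k. v k j x)"
    using conv J by (intro AE_finite_allI) auto
  then obtain Z where Z: "\<And>x. x \<in> space M - Z \<Longrightarrow> \<forall>j\<in>J. convergent (\<lambda>k. v k j x)" "Z \<in> null_sets M"
    by (rule AE_E3) blast
  define w where "w j x = (if x \<in> Z then v 0 j x else lim (\<lambda>k. v k j x))" for j x
  have lim: "(\<lambda>k. v k j x) \<longlonglongrightarrow> w j x" if "x \<in> space M - Z" "j \<in> J" for x j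
    using Z(1)[OF that(1)] that by (simp add: w_def convergent_LIMSEQ_iff)
  show ?thesis
  proof (rule that[of w])
    fix j assume j: "j \<in> J"
    show "w j \<in> borel_measurable M"
      unfolding w_def using meas[OF j] Z(2)
      by (intro measurable_If_set borel_measurable_lim_metric) (auto intro: sets.Int)
    have "AE x in M. x \<notin> Z" by (rule AE_not_in[OF Z(2)])
    then show "AE x in M. (\<lambda>k. v k j x) \<longlonglongrightarrow> w j x"
      by (rule AE_mp) (use lim j in \<open>auto intro!: AE_I2\<close>)
  next
    fix x assume "x \<in> space M"
    then show "(\<forall>j\<in>J. w j x = v 0 j x) \<or> (\<forall>j\<in>J. (\<lambda>k. v k j x) \<longlonglongrightarrow> w j x)"
      using lim by (cases "x \<in> Z") (auto simp: w_def)
  qed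
qed

context signal_structure
begin

text \<open>Weights on the states are read as a prior, for which a nearly optimal selection does at
  least as well as \<open>r\<close> up to \<open>e\<close>. This provides the \<open>opt\<close>
  premise of \<open>payoff_attained\<close>.\<close>

lemma weights_selection:
  assumes P: "continuous_problem n A u"
    and opt: "\<And>q. q \<in> belief_simplex n \<Longrightarrow> (\<Sum>i\<le>n. full_belief n q i * r i) \<le> bayes_expect q (value_fn n A u)"
    and l: "\<And>i. i \<le> n \<Longrightarrow> 0 \<le> l i" "(\<Sum>i\<le>n. l i) = 1" and e: "0 < e"
  shows "\<exists>s\<in>borel_measurable M. (\<forall>x. s x \<in> A) \<and> (\<forall>i\<le>n. (\<lambda>x. u (s x) i) \<in> borel_measurable M) \<and>
    (\<Sum>i\<le>n. l i * r i) - e \<le> (\<Sum>i\<le>n. l i * (\<integral>x. u (s x) i * f i x \<partial>M))"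
proof -
  have lq: "l \<in> belief_simplex n" and fl: "\<And>i. full_belief n l i = l i"
    by (rule full_belief_weights; use l in simp)+
  from near_optimal_selection[OF P lq e] opt[OF lq] show ?thesis
    unfolding fl by (meson diff_right_mono order_trans)
qed

text \<open>Here \<open>W\<close> consists of mixed strategies, given by the probability
  \<open>w a x\<close> of each action \<open>a\<close> at signal \<open>x\<close>. These weights
  form a bounded convex class closed under the limits in question, and \<open>c\<close> is the
  utility table.\<close>

lemma finite_strategy_attains:
  assumes M: "finite_measure M" and A: "finite A" "A \<noteq> {}"
    and opt: "\<And>q. q \<in> belief_simplex n \<Longrightarrow> (\<Sum>i\<le>n. full_belief n q i * r i) \<le> bayes_expect q (value_fn n A u)"
  shows "\<exists>\<sigma>\<in>M \<rightarrow>\<^sub>M prob_algebra (restrict_space borel A). \<forall>i\<le>n. r i \<le> (\<integral>x. (\<integral>t. u t i \<partial>\<sigma> x) * f i x \<partial>M)"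
proof -
  have P: "continuous_problem n A u"
    using A by unfold_locales (simp_all add: finite_imp_compact continuous_on_finite)
  define W where "W = {w :: real \<Rightarrow> real \<Rightarrow> real. (\<forall>a\<in>A. w a \<in> borel_measurable M) \<and>
    (\<forall>x\<in>space M. (\<forall>a\<in>A. 0 \<le> w a x) \<and> (\<Sum>a\<in>A. w a x) = 1)}"
  have "\<exists>w\<in>W. \<forall>i\<le>n. r i \<le> (\<integral>x. (\<Sum>a\<in>A. w a x * u a i) * f i x \<partial>M)"
  proof (rule payoff_attained[where B=1, OF M A(1) dens_integrable])
    show "w a \<in> borel_measurable M" if "w \<in> W" "a \<in> A" for w a
      using that by (simp add: W_def)
    show "\<bar>w a x\<bar> \<le> 1" if w: "w \<in> W" and a: "a \<in> A" and x: "x \<in> space M" for w a x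
    proof -
      have "w a x \<le> (\<Sum>a\<in>A. w a x)"
        by (rule member_le_sum[OF a _ A(1), of "\<lambda>a. w a x"]) (use w x in \<open>auto simp: W_def\<close>)
      with w a x show ?thesis by (auto simp: W_def)
    qed
    show "(\<lambda>j x. (1 - s) * w j x + s * w' j x) \<in> W" if "w \<in> W" "w' \<in> W" "0 \<le> s" "s \<le> 1" for w w' s
      using that unfolding W_def
      by (auto intro!: borel_measurable_add borel_measurable_times simp: sum.distrib simp flip: sum_distrib_left)
    show "\<exists>w\<in>W. \<forall>a\<in>A. AE x in M. (\<lambda>k. v k a x) \<longlonglongrightarrow> w a x"
      if v: "\<And>k. v k \<in> W" and c: "\<And>a. a \<in> A \<Longrightarrow> AE x in M. convergent (\<lambda>k. v k a x)" for v
    proof -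
      have vm: "v k a \<in> borel_measurable M" if "a \<in> A" for k a using v[of k] that by (simp add: W_def)
      obtain w where w: "\<And>a. a \<in> A \<Longrightarrow> w a \<in> borel_measurable M"
        "\<And>x. x \<in> space M \<Longrightarrow> (\<forall>a\<in>A. w a x = v 0 a x) \<or> (\<forall>a\<in>A. (\<lambda>k. v k a x) \<longlonglongrightarrow> w a x)"
        "\<And>a. a \<in> A \<Longrightarrow> AE x in M. (\<lambda>k. v k a x) \<longlonglongrightarrow> w a x"
        using AE_limit_representative[of A v M, OF A(1) vm c] by blast
      have "(\<forall>a\<in>A. 0 \<le> w a x) \<and> (\<Sum>a\<in>A. w a x) = 1" if x: "x \<in> space M" for x
        using w(2)[OF x]
      proof
        assume "\<forall>a\<in>A. w a x = v 0 a x"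
        then show ?thesis using v[of 0] x by (simp add: W_def)
      next
        assume lim: "\<forall>a\<in>A. (\<lambda>k. v k a x) \<longlonglongrightarrow> w a x"
        have "(\<lambda>k. \<Sum>a\<in>A. v k a x) \<longlonglongrightarrow> (\<Sum>a\<in>A. w a x)" using lim by (intro tendsto_sum) auto
        then have "(\<lambda>k. 1) \<longlonglongrightarrow> (\<Sum>a\<in>A. w a x)" using v x by (simp add: W_def)
        then have "(\<Sum>a\<in>A. w a x) = 1" using LIMSEQ_unique tendsto_const by metis
        moreover have "0 \<le> w a x" if "a \<in> A" for a
          by (rule LIMSEQ_le_const[of "\<lambda>k. v k a x"]) (use lim that v x in \<open>auto simp: W_def\<close>)
        ultimately show ?thesis by blast
      qed
      with w(1,3) show ?thesis by (intro bexI[of _ w]) (auto simp: W_def)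
    qed
    show "\<exists>w\<in>W. (\<Sum>i\<le>n. l i * r i) - e \<le> (\<Sum>i\<le>n. l i * (\<integral>x. (\<Sum>a\<in>A. w a x * u a i) * f i x \<partial>M))"
      if l: "\<And>i. i \<le> n \<Longrightarrow> 0 \<le> l i" "(\<Sum>i\<le>n. l i) = 1" "0 < e" for l e
    proof -
      obtain s where s: "s \<in> borel_measurable M" "\<And>x. s x \<in> A"
        and le: "(\<Sum>i\<le>n. l i * r i) - e \<le> (\<Sum>i\<le>n. l i * (\<integral>x. u (s x) i * f i x \<partial>M))"
        using weights_selection[OF P opt l] by blast
      \<comment> \<open>The pure strategy \<open>s\<close> as a mixed one: indicator weights on the
        selected action.\<close>
      define w where "w a x = (if s x = a then 1 else 0 :: real)" for a x
      have "w a \<in> borel_measurable M" for a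
        unfolding w_def using s(1) by measurable
      moreover have "(\<Sum>a\<in>A. w a x) = 1" for x
        unfolding w_def using A(1) s(2) by simp
      ultimately have "w \<in> W" by (auto simp: W_def w_def)
      moreover have "(\<Sum>a\<in>A. w a x * u a i) = u (s x) i" for x i
        unfolding w_def using A(1) s(2) by (simp add: if_distrib[of "\<lambda>c. c * _"] cong: if_cong)
      ultimately show ?thesis using le by (intro bexI[of _ w]) simp_all
    qed
  qed
  then obtain w where w: "\<And>a. a \<in> A \<Longrightarrow> w a \<in> borel_measurable M"
    "\<And>x a. x \<in> space M \<Longrightarrow> a \<in> A \<Longrightarrow> 0 \<le> w a x" "\<And>x. x \<in> space M \<Longrightarrow> (\<Sum>a\<in>A. w a x) = 1"
    and le: "\<And>i. i \<le> n \<Longrightarrow> r i \<le> (\<integral>x. (\<Sum>a\<in>A. w a x * u a i) * f i x \<partial>M)"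
    unfolding W_def by blast
  \<comment> \<open>The weights become measures on \<open>A\<close>; since every subset of the
    finite set \<open>A\<close> is Borel, point measures carry the required sigma-algebra.\<close>
  define \<sigma> where "\<sigma> x = point_measure A (\<lambda>a. ennreal (w a x))" for x
  have sets_A: "sets (restrict_space borel A) = Pow A"
  proof
    show "Pow A \<subseteq> sets (restrict_space borel A)"
    proof
      fix X assume "X \<in> Pow A"
      then have "finite X" "X = A \<inter> X" using A(1) finite_subset by auto
      then show "X \<in> sets (restrict_space borel A)"
        unfolding sets_restrict_space by (intro image_eqI[of _ _ X]) (auto intro: borel_closed finite_imp_closed)
    qed
  qed (auto simp: sets_restrict_space)
  have prob: "prob_space (\<sigma> x)" if x: "x \<in> space M" for x
  proof
    have "emeasure (\<sigma> x) A = (\<Sum>a\<in>A. ennreal (w a x))"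
      unfolding \<sigma>_def by (rule emeasure_point_measure_finite[OF A(1)]) simp
    also have "\<dots> = ennreal (\<Sum>a\<in>A. w a x)" by (rule sum_ennreal) (rule w(2)[OF x])
    finally show "emeasure (\<sigma> x) (space (\<sigma> x)) = 1"
      using w(3)[OF x] by (simp add: \<sigma>_def space_point_measure)
  qed
  have \<sigma>: "\<sigma> \<in> M \<rightarrow>\<^sub>M prob_algebra (restrict_space borel A)"
  proof (intro measurable_prob_algebraI measurable_subprob_algebra)
    fix X assume "X \<in> sets (restrict_space borel A)"
    then have X: "X \<subseteq> A" by (simp add: sets_A)
    then have "(\<lambda>x. emeasure (\<sigma> x) X) = (\<lambda>x. \<Sum>a\<in>X. ennreal (w a x))"
      unfolding \<sigma>_def using emeasure_point_measure_finite[OF A(1) X] by simp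
    also have "\<dots> \<in> borel_measurable M"
      by (intro borel_measurable_sum measurable_compose[OF w(1) measurable_ennreal]) (use X in auto)
    finally show "(\<lambda>x. emeasure (\<sigma> x) X) \<in> borel_measurable M" .
  qed (use prob in \<open>auto simp: sets_A \<sigma>_def sets_point_measure intro: prob_space_imp_subprob_space\<close>)
  have "r i \<le> (\<integral>x. (\<integral>t. u t i \<partial>\<sigma> x) * f i x \<partial>M)" if i: "i \<le> n" for i
  proof -
    have "(\<integral>x. (\<integral>t. u t i \<partial>\<sigma> x) * f i x \<partial>M) = (\<integral>x. (\<Sum>a\<in>A. w a x * u a i) * f i x \<partial>M)"
      by (rule Bochner_Integration.integral_cong)
        (simp_all add: \<sigma>_def lebesgue_integral_point_measure_finite[OF A(1)] w(2))
    with le[OF i] show ?thesis by simp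
  qed
  with \<sigma> show ?thesis by blast
qed

end

text \<open>Convexity of the set of dominated profiles. By \<open>ex_nonneg_profile\<close> only
  mixtures of two states need checking, and there \<open>a\<close> or \<open>a'\<close> already does
  at least as well as the mixed profile.\<close>

lemma QCC_dominated_mixture:
  assumes u: "\<And>i. i \<le> n \<Longrightarrow> continuous_on {c..d} (\<lambda>a. u a i)" and qcc: "QCC n {c..d} u"
    and a: "a \<in> {c..d}" "\<And>i. i \<le> n \<Longrightarrow> w i \<le> u a i"
    and a': "a' \<in> {c..d}" "\<And>i. i \<le> n \<Longrightarrow> w' i \<le> u a' i" and s: "0 \<le> s" "s \<le> 1"
  shows "\<exists>b\<in>{c..d}. \<forall>i\<le>n. (1 - s) * w i + s * w' i \<le> u b i"
proof -
  define W where "W i = (1 - s) * w i + s * w' i" for i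
  have "\<exists>b\<in>{c..d}. \<forall>i\<le>n. 0 \<le> u b i - W i"
  proof (rule ex_nonneg_profile)
    show "continuous_on {c..d} (\<lambda>a. u a i - W i)" if "i \<le> n" for i
      by (intro continuous_intros u that)
  next
    fix i j and t :: real assume ij: "i \<le> n" "j \<le> n" and t: "0 \<le> t" "t \<le> 1"
    \<comment> \<open>The belief with mass \<open>1 - t\<close> on state \<open>i\<close> and
      \<open>t\<close> on state \<open>j\<close>; for \<open>i = j\<close> it is a point
      mass.\<close>
    define p where "p k = (1 - t) * of_bool (k = i) + t * of_bool (k = j)" for k
    have sum_p: "(\<Sum>k\<le>n. p k * x k) = (1 - t) * x i + t * x j" for x :: "nat \<Rightarrow> real"
    proof -
      have "(\<Sum>k\<le>n. p k * x k) = (\<Sum>k\<le>n. if k = i then (1 - t) * x k else 0) + (\<Sum>k\<le>n. if k = j then t * x k else 0)"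
        unfolding sum.distrib[symmetric] by (rule sum.cong) (auto simp: p_def algebra_simps)
      then show ?thesis using ij by simp
    qed
    have p1: "\<And>k. k \<le> n \<Longrightarrow> 0 \<le> p k" "(\<Sum>k\<le>n. p k) = 1"
      using t sum_p[of "\<lambda>_. 1"] by (auto simp: p_def)
    have p: "p \<in> belief_simplex n" and fp: "\<And>k. full_belief n p k = p k"
      by (rule full_belief_weights; use p1 in simp)+
    have eu: "exp_util n u b p = (1 - t) * u b i + t * u b j" for b
      unfolding exp_util_def atLeast0AtMost fp by (rule sum_p)
    have qu: "quasiconcave_on {c..d} (\<lambda>b. (1 - t) * u b i + t * u b j)"
      using qcc p unfolding QCC_def by (auto simp: eu)
    have eq: "(1 - t) * (u b i - W i) + t * (u b j - W j)
        = ((1 - t) * u b i + t * u b j) - ((1 - t) * W i + t * W j)" for b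
      by (simp add: algebra_simps)
    show "quasiconcave_on {c..d} (\<lambda>b. (1 - t) * (u b i - W i) + t * (u b j - W j))"
      unfolding eq using qu by (auto simp: quasiconcave_on_def min_def split: if_splits)
    let ?h = "\<lambda>b. (1 - t) * u b i + t * u b j"
    have h: "(1 - t) * w i + t * w j \<le> ?h a" "(1 - t) * w' i + t * w' j \<le> ?h a'"
      using t a(2) a'(2) ij by (intro add_mono mult_left_mono; simp)+
    have "(1 - s) * ((1 - t) * w i + t * w j) + s * ((1 - t) * w' i + t * w' j) \<le> (1 - s) * ?h a + s * ?h a'"
      by (rule add_mono[OF mult_left_mono[OF h(1)] mult_left_mono[OF h(2)]]) (use s in simp_all)
    moreover have "(1 - t) * W i + t * W j = (1 - s) * ((1 - t) * w i + t * w j) + s * ((1 - t) * w' i + t * w' j)"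
      by (simp add: W_def algebra_simps)
    moreover have "(1 - s) * ?h a + s * ?h a' \<le> max (?h a) (?h a')"
      by (rule convex_bound_le[OF max.cobounded1 max.cobounded2]) (use s in simp_all)
    ultimately have "(1 - t) * W i + t * W j \<le> ?h a \<or> (1 - t) * W i + t * W j \<le> ?h a'"
      by (simp add: le_max_iff_disj[symmetric])
    then show "\<exists>b\<in>{c..d}. 0 \<le> (1 - t) * (u b i - W i) + t * (u b j - W j)"
      unfolding eq using a(1) a'(1) by auto
  qed
  then show ?thesis by (simp add: W_def)
qed

context signal_structure
begin

text \<open>Here \<open>W\<close> consists of bounded measurable utility profiles that are dominated
  at every signal by some action. After a profile with sufficient payoffs is found, playing its
  least dominating action gives a measurable pure strategy that earns at least as much in each
  state.\<close>

lemma interval_strategy_attains: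
  assumes M: "finite_measure M" and cd: "c \<le> d"
    and u: "\<And>i. i \<le> n \<Longrightarrow> continuous_on {c..d} (\<lambda>a. u a i)" and qcc: "QCC n {c..d} u"
    and opt: "\<And>q. q \<in> belief_simplex n \<Longrightarrow> (\<Sum>i\<le>n. full_belief n q i * r i) \<le> bayes_expect q (value_fn n {c..d} u)"
  shows "\<exists>\<sigma>\<in>M \<rightarrow>\<^sub>M prob_algebra (restrict_space borel {c..d}). \<forall>i\<le>n. r i \<le> (\<integral>x. (\<integral>t. u t i \<partial>\<sigma> x) * f i x \<partial>M)"
proof -
  have P: "continuous_problem n {c..d} u"
    using cd u by unfold_locales auto
  interpret P: continuous_problem n "{c..d}" u by (rule P)
  obtain D where D: "\<And>a i. a \<in> {c..d} \<Longrightarrow> i \<le> n \<Longrightarrow> \<bar>u a i\<bar> \<le> D" using P.bounded_util by blast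
  define W where "W = {w :: nat \<Rightarrow> real \<Rightarrow> real. (\<forall>i\<le>n. w i \<in> borel_measurable M) \<and>
    (\<forall>x\<in>space M. (\<forall>i\<le>n. \<bar>w i x\<bar> \<le> D) \<and> (\<exists>a\<in>{c..d}. \<forall>i\<le>n. w i x \<le> u a i))}"
  have coord: "(\<Sum>j\<in>{..n}. w j x * of_bool (j = i)) = w i x" if "i \<le> n" for w :: "nat \<Rightarrow> real \<Rightarrow> real" and x i
    using that by (simp add: of_bool_def if_distrib[of "\<lambda>c. _ * c"] cong: if_cong)
  have "\<exists>w\<in>W. \<forall>i\<le>n. r i \<le> (\<integral>x. (\<Sum>j\<in>{..n}. w j x * of_bool (j = i)) * f i x \<partial>M)"
  proof (rule payoff_attained[where B=D, OF M finite_atMost dens_integrable])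
    show "w i \<in> borel_measurable M" if "w \<in> W" "i \<in> {..n}" for w i
      using that by (simp add: W_def)
    show "\<bar>w i x\<bar> \<le> D" if "w \<in> W" "i \<in> {..n}" "x \<in> space M" for w i x
      using that by (simp add: W_def)
    show "(\<lambda>i x. (1 - s) * w i x + s * w' i x) \<in> W" if w: "w \<in> W" "w' \<in> W" and s: "0 \<le> s" "s \<le> 1" for w w' s
    proof -
      have "\<bar>(1 - s) * w i x + s * w' i x\<bar> \<le> D" if "x \<in> space M" "i \<le> n" for x i
      proof -
        have "\<bar>(1 - s) * w i x + s * w' i x\<bar> \<le> (1 - s) * \<bar>w i x\<bar> + s * \<bar>w' i x\<bar>"
          using s by (intro order_trans[OF abs_triangle_ineq]) (simp add: abs_mult)
        also have "\<dots> \<le> D"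
          using w that s by (intro convex_bound_le) (auto simp: W_def)
        finally show ?thesis .
      qed
      moreover have "\<exists>b\<in>{c..d}. \<forall>i\<le>n. (1 - s) * w i x + s * w' i x \<le> u b i" if x: "x \<in> space M" for x
      proof -
        obtain a a' where "a \<in> {c..d}" "\<forall>i\<le>n. w i x \<le> u a i" "a' \<in> {c..d}" "\<forall>i\<le>n. w' i x \<le> u a' i"
          using w x unfolding W_def by blast
        then show ?thesis
          by (intro QCC_dominated_mixture[OF u qcc, of a "\<lambda>i. w i x" a' "\<lambda>i. w' i x"] s) auto
      qed
      ultimately show ?thesis using w unfolding W_def
        by (auto intro!: borel_measurable_add borel_measurable_times)
    qed
    show "\<exists>w\<in>W. \<forall>i\<in>{..n}. AE x in M. (\<lambda>k. v k i x) \<longlonglongrightarrow> w i x"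
      if v: "\<And>k. v k \<in> W" and conv: "\<And>i. i \<in> {..n} \<Longrightarrow> AE x in M. convergent (\<lambda>k. v k i x)" for v
    proof -
      have vm: "v k i \<in> borel_measurable M" if "i \<in> {..n}" for k i using v[of k] that by (simp add: W_def)
      obtain w where w: "\<And>i. i \<in> {..n} \<Longrightarrow> w i \<in> borel_measurable M"
        "\<And>x. x \<in> space M \<Longrightarrow> (\<forall>i\<in>{..n}. w i x = v 0 i x) \<or> (\<forall>i\<in>{..n}. (\<lambda>k. v k i x) \<longlonglongrightarrow> w i x)"
        "\<And>i. i \<in> {..n} \<Longrightarrow> AE x in M. (\<lambda>k. v k i x) \<longlonglongrightarrow> w i x"
        using AE_limit_representative[of "{..n}" v M, OF finite_atMost vm conv] by blast
      have "(\<forall>i\<le>n. \<bar>w i x\<bar> \<le> D) \<and> (\<exists>a\<in>{c..d}. \<forall>i\<le>n. w i x \<le> u a i)" if x: "x \<in> space M" for x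
        using w(2)[OF x]
      proof
        assume "\<forall>i\<in>{..n}. w i x = v 0 i x"
        then show ?thesis using v[of 0] x by (simp add: W_def)
      next
        assume lim: "\<forall>i\<in>{..n}. (\<lambda>k. v k i x) \<longlonglongrightarrow> w i x"
        have "\<bar>w i x\<bar> \<le> D" if "i \<le> n" for i
        proof (rule LIMSEQ_le_const2)
          show "(\<lambda>k. \<bar>v k i x\<bar>) \<longlonglongrightarrow> \<bar>w i x\<bar>" using lim that by (intro tendsto_rabs) simp
          show "\<exists>N. \<forall>k\<ge>N. \<bar>v k i x\<bar> \<le> D" using v that x by (simp add: W_def)
        qed
        moreover have "\<exists>a\<in>{c..d}. \<forall>i\<le>n. w i x \<le> u a i"
          by (rule dominated_profile_limit[OF compact_Icc u, where w="\<lambda>k i. v k i x"])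
            (use lim v x in \<open>auto simp: W_def\<close>)
        ultimately show ?thesis by blast
      qed
      with w(1,3) show ?thesis by (intro bexI[of _ w]) (auto simp: W_def)
    qed
    show "\<exists>w\<in>W. (\<Sum>i\<le>n. l i * r i) - e
        \<le> (\<Sum>i\<le>n. l i * (\<integral>x. (\<Sum>j\<in>{..n}. w j x * of_bool (j = i)) * f i x \<partial>M))"
      if l: "\<And>i. i \<le> n \<Longrightarrow> 0 \<le> l i" "(\<Sum>i\<le>n. l i) = 1" "0 < e" for l e
    proof -
      obtain s where s: "\<And>x. s x \<in> {c..d}" "\<And>i. i \<le> n \<Longrightarrow> (\<lambda>x. u (s x) i) \<in> borel_measurable M"
        and le: "(\<Sum>i\<le>n. l i * r i) - e \<le> (\<Sum>i\<le>n. l i * (\<integral>x. u (s x) i * f i x \<partial>M))"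
        using weights_selection[OF P opt l] by blast
      have "(\<lambda>i x. u (s x) i) \<in> W"
        using s D[OF s(1)] by (auto simp: W_def intro!: bexI[of _ "s _"])
      then show ?thesis using le coord by (intro bexI[of _ "\<lambda>i x. u (s x) i"]) simp_all
    qed
  qed
  then obtain w where wW: "w \<in> W"
    and "\<forall>i\<le>n. r i \<le> (\<integral>x. (\<Sum>j\<in>{..n}. w j x * of_bool (j = i)) * f i x \<partial>M)"
    by blast
  then have le: "r i \<le> (\<integral>x. w i x * f i x \<partial>M)" if "i \<le> n" for i
    using that coord by simp
  have w: "\<And>i. i \<le> n \<Longrightarrow> w i \<in> borel_measurable M"
    "\<And>x i. x \<in> space M \<Longrightarrow> i \<le> n \<Longrightarrow> \<bar>w i x\<bar> \<le> D"
    "\<And>x. x \<in> space M \<Longrightarrow> \<exists>a\<in>{c..d}. \<forall>i\<le>n. w i x \<le> u a i"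
    using wW by (simp_all add: W_def)
  \<comment> \<open>Padding by zeros beyond \<open>n\<close> turns the profile into a measurable map
    into all real sequences, so that \<open>closed_dominated_profiles\<close> can be used.\<close>
  define z where "z x i = (if i \<le> n then w i x else 0)" for x i
  have z: "z \<in> borel_measurable M"
  proof (rule measurable_coordinatewise_then_product)
    show "(\<lambda>x. z x i) \<in> borel_measurable M" for i
      using w(1) by (cases "i \<le> n") (simp_all add: z_def)
  qed
  define S where "S x = {a\<in>{c..d}. \<forall>i\<le>n. w i x \<le> u a i}" for x
  have S_inf: "\<exists>a\<in>S x. \<forall>b\<in>S x. a \<le> b" if "x \<in> space M" for x
  proof (rule compact_attains_inf)
    have "S x = {c..d} \<inter> (\<Inter>i\<in>{..n}. {c..d} \<inter> (\<lambda>a. u a i) -` {w i x..})" by (auto simp: S_def)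
    moreover have "closed ({c..d} \<inter> (\<lambda>a. u a i) -` {w i x..})" if "i \<le> n" for i
      by (rule continuous_closed_preimage[OF u[OF that]]) auto
    ultimately show "compact (S x)"
      by (metis (no_types, lifting) atMost_iff closed_INT compact_Icc compact_Int_closed)
    show "S x \<noteq> {}" using w(3)[OF that] by (auto simp: S_def)
  qed
  \<comment> \<open>Taking the least dominating action yields measurability:
    \<open>b x \<le> t\<close> holds exactly if some action in \<open>{c..min d t}\<close> dominates
    the profile at \<open>x\<close>, and such profiles form a closed set.\<close>
  define b where "b x = (SOME a. a \<in> S x \<and> (\<forall>a'\<in>S x. a \<le> a'))" for x
  have b: "b x \<in> S x \<and> (\<forall>a'\<in>S x. b x \<le> a')" if "x \<in> space M" for x
    unfolding b_def by (rule someI_ex) (use S_inf[OF that] in blast)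
  have "b \<in> borel_measurable M"
    unfolding borel_measurable_iff_le
  proof
    fix t
    let ?T = "{w :: nat \<Rightarrow> real. \<exists>a\<in>{c..min d t}. \<forall>i\<le>n. w i \<le> u a i}"
    have "closed ?T"
      by (rule closed_dominated_profiles[OF compact_Icc continuous_on_subset[OF u]]) auto
    then have "z -` ?T \<inter> space M \<in> sets M"
      by (intro measurable_sets[OF z] borel_closed)
    also have "z -` ?T \<inter> space M = {x \<in> space M. b x \<le> t}"
    proof (intro set_eqI iffI)
      fix x assume x: "x \<in> z -` ?T \<inter> space M"
      then obtain a where "a \<in> S x" "a \<le> t" by (auto simp: z_def S_def)
      with b[of x] x show "x \<in> {x \<in> space M. b x \<le> t}" by (auto intro: order_trans)
    next
      fix x assume "x \<in> {x \<in> space M. b x \<le> t}"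
      with b[of x] show "x \<in> z -` ?T \<inter> space M"
        by (auto simp: z_def S_def intro!: bexI[of _ "b x"])
    qed
    finally show "{x \<in> space M. b x \<le> t} \<in> sets M" .
  qed
  then have bA: "b \<in> M \<rightarrow>\<^sub>M restrict_space borel {c..d}"
    by (intro measurable_restrict_space2) (use b in \<open>auto simp: S_def\<close>)
  define \<sigma> where "\<sigma> x = return (restrict_space borel {c..d}) (b x)" for x
  have \<sigma>: "\<sigma> \<in> M \<rightarrow>\<^sub>M prob_algebra (restrict_space borel {c..d})"
    unfolding \<sigma>_def by (rule measurable_compose[OF bA measurable_return_prob_space])
  have "r i \<le> (\<integral>x. (\<integral>t. u t i \<partial>\<sigma> x) * f i x \<partial>M)" if i: "i \<le> n" for i
  proof -
    have um: "(\<lambda>a. u a i) \<in> borel_measurable (restrict_space borel {c..d})"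
      by (rule borel_measurable_continuous_on_restrict[OF u[OF i]])
    have bx: "b x \<in> {c..d}" "w i x \<le> u (b x) i" if "x \<in> space M" for x
      using b[OF that] i by (auto simp: S_def)
    have int: "integrable M (\<lambda>x. h x * f i x)" if "h \<in> borel_measurable M" "\<And>x. x \<in> space M \<Longrightarrow> \<bar>h x\<bar> \<le> D" for h
    proof (rule Bochner_Integration.integrable_bound[of _ "\<lambda>x. D * f i x"])
      show "AE x in M. norm (h x * f i x) \<le> norm (D * f i x)"
        using that(2) by (intro AE_I2) (auto intro: abs_mult_le_abs_mult)
    qed (use dens_integrable[OF i] that(1) in auto)
    have "r i \<le> (\<integral>x. w i x * f i x \<partial>M)" by (rule le[OF i])
    also have "\<dots> \<le> (\<integral>x. u (b x) i * f i x \<partial>M)"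
      by (intro integral_mono int w(1)[OF i] measurable_compose[OF bA um] mult_right_mono)
        (use w(2)[OF _ i] D[OF bx(1) i] bx(2) dens_nonneg[OF i] in auto)
    also have "\<dots> = (\<integral>x. (\<integral>t. u t i \<partial>\<sigma> x) * f i x \<partial>M)"
    proof (rule Bochner_Integration.integral_cong[OF refl])
      fix x assume "x \<in> space M"
      then have "(\<integral>t. u t i \<partial>\<sigma> x) = u (b x) i"
        unfolding \<sigma>_def by (intro integral_return um) (use bx(1) in \<open>simp add: space_restrict_space\<close>)
      then show "u (b x) i * f i x = (\<integral>t. u t i \<partial>\<sigma> x) * f i x" by simp
    qed
    finally show ?thesis .
  qed
  with \<sigma> show ?thesis by blast
qed

end

subsection \<open>The equivalence\<close>

lemma Icc_lborel: "{a..b} \<inter> space lborel \<in> sets lborel" for a b :: real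
  by simp

lemma experiment_signal_structure:
  assumes "is_experiment n a b f"
  shows "signal_structure n (restrict_space lborel {a..b}) f"
  using assms unfolding is_experiment_def set_integrable_def set_lebesgue_integral_def
  by unfold_locales
    (auto simp: integrable_restrict_space[OF Icc_lborel] integral_restrict_space[OF Icc_lborel] space_restrict_space)

lemma post_expect_eq:
  assumes "is_experiment n a b f"
  shows "post_expect n a b f q h = signal_structure.bayes_expect n (restrict_space lborel {a..b}) f q h"
  unfolding signal_structure.bayes_expect_def[OF experiment_signal_structure[OF assms]] post_expect_def
  by (simp add: set_lebesgue_integral_def integral_restrict_space[OF Icc_lborel])

lemma strat_util_eq:
  "strat_util a b f u \<sigma> i = (\<integral>x. (\<integral>t. u t i \<partial>\<sigma> x) * f i x \<partial>restrict_space lborel {a..b})"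
  by (simp add: strat_util_def set_lebesgue_integral_def integral_restrict_space[OF Icc_lborel])

lemma is_strategy_iff:
  "is_strategy a b A \<sigma> \<longleftrightarrow> \<sigma> \<in> restrict_space lborel {a..b} \<rightarrow>\<^sub>M prob_algebra (restrict_space borel A)"
proof -
  have "sets (restrict_space borel {a..b}) = sets (restrict_space lborel {a..b})"
    by (simp add: sets_restrict_space)
  from measurable_cong_sets[OF this refl] show ?thesis
    unfolding is_strategy_def by blast
qed

lemma finite_measure_Icc: "finite_measure (restrict_space lborel {a..b})" for a b :: real
  by (rule finite_measureI) (simp add: emeasure_restrict_space space_restrict_space emeasure_lborel_Icc_eq)

theorem theorem1:
  fixes n :: nat and xa xb ya yb :: real and f g :: "nat \<Rightarrow> real \<Rightarrow> real"
  assumes F: "is_experiment n xa xb f"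
      and G: "is_experiment n ya yb g"
  shows "(lb_dominates n xa xb f ya yb g \<longleftrightarrow>
            (\<forall>A u. decision_problem n A u \<and> QCC n A u \<longrightarrow>
               (\<forall>q\<in>belief_simplex n. Vbar n xa xb f A u q \<ge> Vbar n ya yb g A u q)))
       \<and> (lb_dominates n xa xb f ya yb g \<longleftrightarrow>
            (\<forall>A u. decision_problem n A u \<and> QCC n A u \<longrightarrow>
               (\<forall>\<sigma>G. is_strategy ya yb A \<sigma>G \<longrightarrow>
                  (\<exists>\<sigma>F. is_strategy xa xb A \<sigma>F \<and>
                     (\<forall>i\<le>n. strat_util xa xb f u \<sigma>F i \<ge> strat_util ya yb g u \<sigma>G i)))))"
    (is "(?LB \<longleftrightarrow> ?Value) \<and> (?LB \<longleftrightarrow> ?Strategy)")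
proof -
  interpret experiment_pair n "restrict_space lborel {xa..xb}" f "restrict_space lborel {ya..yb}" g
    by (intro experiment_pair.intro experiment_signal_structure F G)
  note eqs = post_expect_eq[OF F] post_expect_eq[OF G]
  have LB_Value: "?Value" if LB: ?LB
    unfolding Vbar_def eqs
    by (intro allI impI ballI QCC_value_le decision_problem_continuous)
      (use LB in \<open>auto simp: lb_dominates_def eqs\<close>)
  \<comment> \<open>The tangent construction produces only finite action sets, which are decision
    problems for any utility.\<close>
  have Value_LB: "?LB" if val: ?Value
    unfolding lb_dominates_def eqs
    by (intro ballI allI impI convex_expect_le)
      (use val in \<open>auto simp: Vbar_def eqs decision_problem_def\<close>)
  have Strategy_Value: "?Value" if strat: ?Strategy
    unfolding Vbar_def eqs
  proof (intro allI impI ballI, elim conjE)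
    fix A u q assume A: "decision_problem n A u" "QCC n A u" and q: "q \<in> belief_simplex n"
    show "G.bayes_expect q (value_fn n A u) \<le> F.bayes_expect q (value_fn n A u)"
      by (rule strategies_value_le[OF q decision_problem_continuous[OF A(1)]])
        (use strat A in \<open>auto simp: is_strategy_iff strat_util_eq Bex_def\<close>)
  qed
  have Value_Strategy: "?Strategy" if val: ?Value
  proof (intro allI impI, elim conjE)
    fix A u \<tau> assume A: "decision_problem n A u" "QCC n A u" and \<tau>: "is_strategy ya yb A \<tau>"
    define r where "r = strat_util ya yb g u \<tau>"
    \<comment> \<open>For every prior, the weighted payoffs of the given strategy are bounded by the
      value under \<open>G\<close> and hence under \<open>F\<close>; this is the premise from which
      both attainment lemmas build a dominating strategy.\<close>
    have opt: "(\<Sum>i\<le>n. full_belief n q i * r i) \<le> F.bayes_expect q (value_fn n A u)"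
      if q: "q \<in> belief_simplex n" for q
    proof -
      have "(\<Sum>i\<le>n. full_belief n q i * r i) \<le> G.bayes_expect q (value_fn n A u)"
        unfolding r_def strat_util_eq
        by (rule G.strategy_value_le[OF decision_problem_continuous[OF A(1)] q \<tau>[unfolded is_strategy_iff]])
      also have "\<dots> \<le> F.bayes_expect q (value_fn n A u)"
        using val A q by (simp add: Vbar_def eqs)
      finally show ?thesis .
    qed
    have "\<exists>\<sigma>\<in>restrict_space lborel {xa..xb} \<rightarrow>\<^sub>M prob_algebra (restrict_space borel A).
      \<forall>i\<le>n. r i \<le> (\<integral>x. (\<integral>t. u t i \<partial>\<sigma> x) * f i x \<partial>restrict_space lborel {xa..xb})"
    proof (cases "finite A")
      case True
      with A(1) show ?thesis
        by (intro F.finite_strategy_attains finite_measure_Icc opt) (simp_all add: decision_problem_def)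
    next
      case False
      with A(1) obtain c d where cd: "c \<le> d" "A = {c..d}" "\<forall>i\<le>n. (\<lambda>a. u a i) differentiable_on A"
        unfolding decision_problem_def by blast
      show ?thesis
        unfolding cd(2)
        by (rule F.interval_strategy_attains[OF finite_measure_Icc cd(1)])
          (use cd A(2) opt in \<open>auto intro: differentiable_imp_continuous_on\<close>)
    qed
    then show "\<exists>\<sigma>. is_strategy xa xb A \<sigma> \<and> (\<forall>i\<le>n. strat_util ya yb g u \<tau> i \<le> strat_util xa xb f u \<sigma> i)"
      unfolding is_strategy_iff strat_util_eq r_def[symmetric, unfolded strat_util_eq] Bex_def
      by (simp add: r_def strat_util_eq)
  qed
  note LB_iff = iffI[OF LB_Value Value_LB] and Value_iff = iffI[OF Value_Strategy Strategy_Value]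
  show ?thesis by (rule conjI[OF LB_iff trans[OF LB_iff Value_iff]])
qed

end
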